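(* Let $\mathbb{F}\in\{\mathbb{R},\mathbb{C}\}$, let $A$ be an $n\times m$ matrix over $\mathbb{F}$ and let $r,s\in[1,\infty]$. Then $$\|A\|_{r,s}= m^{[(1/2)-(1/r)]_+}\, n^{[(1/s)-(1/2)]_+}\,\|A\|_{2,2}$$ if and only if $A$ has a singular value decomposition $A=U\Sigma V^*$ (with $U$ an $n\times n$ and $V$ an $m\times m$ unitary matrix over $\mathbb{F}$, i.e. real orthogonal when $\mathbb{F}=\mathbb{R}$, and $\Sigma$ an $n\times m$ nonnegative diagonal matrix) in which (i) the first column of $U$ lies in $K_{\mathrm{sgn}(2-s)}\subset\mathbb{F}^n$, (ii) the first column of $V$ lies in $K_{-\mathrm{sgn}(2-r)}\subset\mathbb{F}^m$, and (iii) the $(1,1)$ entry of $\Sigma$ is its maximal entry.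
   Context: $\|x\|_p$ is the Hölder $\ell_p$ norm; $\|A\|_{p,q}=\max_{x\in\mathbb{F}^m,x\ne0}\|Ax\|_q/\|x\|_p$; for real $A$ one may work over $\mathbb{F}=\mathbb{R}$ or $\mathbb{F}=\mathbb{C}$. $V^*$ is the conjugate transpose. $[z]_+=\max(z,0)$, $\mathrm{sgn}$ is the sign function, $1/\infty=0$. In $\mathbb{F}^k$: $K_1$ = vectors all of whose components have equal absolute values; $K_{-1}$ = vectors with at most one nonzero component; $K_0=\mathbb{F}^k$. *)

theory Defs
  imports "HOL-Library.Extended_Real" "Jordan_Normal_Form.Matrix" "Jordan_Normal_Form.Conjugate"
begin

definition pnorm :: "ereal \<Rightarrow> 'a::real_normed_field vec \<Rightarrow> real" where
  "pnorm p v =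
     (if p = \<infinity> then (if dim_vec v = 0 then 0 else Max {norm (v $ i) | i. i < dim_vec v})
      else (\<Sum>i<dim_vec v. norm (v $ i) powr real_of_ereal p) powr (1 / real_of_ereal p))"

definition opnorm :: "ereal \<Rightarrow> ereal \<Rightarrow> 'a::real_normed_field mat \<Rightarrow> real" where
  "opnorm p q A = Sup {pnorm q (A *\<^sub>v x) / pnorm p x | x.
       x \<in> carrier_vec (dim_col A) \<and> x \<noteq> 0\<^sub>v (dim_col A)}"

definition adjoint_mat :: "'a::conjugatable_field mat \<Rightarrow> 'a mat" where
  "adjoint_mat A = mat (dim_col A) (dim_row A) (\<lambda>(i,j). conjugate (A $$ (j,i)))"

definition unitary_mat :: "nat \<Rightarrow> 'a::conjugatable_field mat \<Rightarrow> bool" where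
  "unitary_mat k U \<longleftrightarrow> U \<in> carrier_mat k k \<and> U * adjoint_mat U = 1\<^sub>m k \<and> adjoint_mat U * U = 1\<^sub>m k"

definition Kset :: "int \<Rightarrow> nat \<Rightarrow> 'a::real_normed_field vec set" where
  "Kset t k = {v \<in> carrier_vec k.
      (t = 1 \<longrightarrow> (\<forall>i<k. \<forall>j<k. norm (v $ i) = norm (v $ j))) \<and>
      (t = -1 \<longrightarrow> (\<forall>i<k. \<forall>j<k. v $ i \<noteq> 0 \<and> v $ j \<noteq> 0 \<longrightarrow> i = j))}"

definition esgn :: "ereal \<Rightarrow> int" where
  "esgn x = (if x > 0 then 1 else if x = 0 then 0 else -1)"

definition is_svd :: "nat \<Rightarrow> nat \<Rightarrow> 'a::{conjugatable_field,real_normed_field} mat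
    \<Rightarrow> 'a mat \<Rightarrow> 'a mat \<Rightarrow> 'a mat \<Rightarrow> bool" where
  "is_svd n m A U \<Sigma> V \<longleftrightarrow> unitary_mat n U \<and> unitary_mat m V \<and> \<Sigma> \<in> carrier_mat n m \<and>
     (\<forall>i<n. \<forall>j<m. i \<noteq> j \<longrightarrow> \<Sigma> $$ (i,j) = 0) \<and>
     (\<forall>i<n. \<forall>j<m. \<exists>t::real. t \<ge> 0 \<and> \<Sigma> $$ (i,j) = of_real t) \<and>
     A = U * \<Sigma> * adjoint_mat V"

definition special_svd :: "ereal \<Rightarrow> ereal \<Rightarrow> nat \<Rightarrow> nat \<Rightarrow>
    'a::{conjugatable_field,real_normed_field} mat \<Rightarrow> bool" where
  "special_svd r s n m A \<longleftrightarrow> (\<exists>U \<Sigma> V. is_svd n m A U \<Sigma> V \<and>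
     col U 0 \<in> Kset (esgn (2 - s)) n \<and>
     col V 0 \<in> Kset (- esgn (2 - r)) m \<and>
     (\<forall>i<n. \<forall>j<m. norm (\<Sigma> $$ (i,j)) \<le> norm (\<Sigma> $$ (0,0))))"

definition norm_identity :: "ereal \<Rightarrow> ereal \<Rightarrow> nat \<Rightarrow> nat \<Rightarrow> 'a::real_normed_field mat \<Rightarrow> bool" where
  "norm_identity r s n m A \<longleftrightarrow>
     opnorm r s A = real m powr (max 0 (1/2 - real_of_ereal (1 / r)))
                  * real n powr (max 0 (real_of_ereal (1 / s) - 1/2)) * opnorm 2 2 A"

end

theory Submission
  imports Defs "HOL-Analysis.Function_Topology" "HOL-Analysis.L2_Norm" "Jordan_Normal_Form.Determinant"
begin

text \<open>
  Comparing $\ell_s$ and $\ell_r$ with $\ell_2$ gives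
  $\|Ax\|_s \le C \|Ax\|_2 \le C \sigma \|x\|_2 \le C D \sigma \|x\|_r$ with $\sigma = \|A\|_{2,2}$,
  where the first and the last step are sharp precisely on the sets $K$. Since the maximum defining
  $\|A\|_{r,s}$ is attained, the norm identity holds iff some $x$ makes all three steps sharp; then $x$ and
  $Ax$ are, up to scaling, a right and a left singular vector for $\sigma$. Such a pair is extended to a
  singular value decomposition by repeatedly maximizing $\|Ax\|_2$ over the unit vectors orthogonal to the
  right singular vectors already found.
\<close>

section \<open>Comparison of Hoelder norms, with equality cases\<close>

text \<open>Both fields are treated at once through a type class that asks for
  \<open>x * conjugate x = |x|^2\<close> and for a compact unit ball; compactness is why the maxima
  used below are attained. That a maximizer of the Euclidean length of A x is a right singular
  vector is proved without eigenvalues or derivatives, from the equality case of Cauchy-Schwarz. It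
  yields two relations, A v = \<sigma> u and A^* u = \<sigma> v. Both are needed: because of them A
  sends the orthogonal complement of the v's into that of the u's, and A^* sends it back, so the
  maximization can be repeated on the complements. Only the first singular value has to be the
  largest. The others need no ordering, since \<sigma> already bounds every quotient of lengths.
  Sharpness of the chain says something about x only if \<sigma> > 0. For the zero matrix every pair
  of unit vectors is a singular pair, and one is simply taken from the sets K.\<close>

lemma powr_tangent_one:
  fixes b c :: real
  assumes "1 < c" "0 \<le> b"
  shows "1 + c * (b - 1) \<le> b powr c" and "b powr c = 1 + c * (b - 1) \<longleftrightarrow> b = 1"
proof -
  \<comment> \<open>This is Bernoulli's inequality for real exponents. With b^c = b * exp ((c - 1) *
    ln b) it follows from exp t > 1 + t for t \<noteq> 0 and from ln b \<ge> 1 - 1/b. At b = 0 the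
    left side is 1 - c < 0.\<close>
  have *: "1 + c * (b - 1) < b powr c" if "b \<noteq> 1"
  proof (cases "b = 0")
    case False
    then have b: "0 < b" using assms by simp
    have l: "1 - 1 / b \<le> ln b"
      using ln_le_minus_one[of "1 / b"] b by (simp add: ln_div)
    have "ln b \<noteq> 0" using that b by simp
    then have "(c - 1) * ln b \<noteq> 0" using assms by simp
    then have e: "1 + (c - 1) * ln b < exp ((c - 1) * ln b)"
      using exp_ge_add_one_self[of "(c - 1) * ln b"] ln_eq_minus_one[of "exp ((c - 1) * ln b)"]
      by (auto simp: order_less_le)
    have "b powr c = b * exp ((c - 1) * ln b)"
      using b powr_add[of b 1 "c - 1"] by (simp add: powr_def)
    then have "b * (1 + (c - 1) * ln b) < b powr c" using e b by simp
    moreover have "b * (1 + (c - 1) * (1 - 1 / b)) \<le> b * (1 + (c - 1) * ln b)"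
      using l b assms by (intro mult_left_mono add_left_mono) auto
    moreover have "b * (1 + (c - 1) * (1 - 1 / b)) = 1 + c * (b - 1)"
      using b by (simp add: field_simps)
    ultimately show ?thesis by simp
  qed (use assms in auto)
  show "1 + c * (b - 1) \<le> b powr c" using * by (cases "b = 1") auto
  show "b powr c = 1 + c * (b - 1) \<longleftrightarrow> b = 1" using * by (cases "b = 1") auto
qed

text \<open>Jensen's inequality by tangents: dividing by the mean makes the numbers
  \<open>t i\<close> average to 1, so the linear terms of \<open>powr_tangent_one\<close> cancel in
  the sum and leave \<open>card I\<close>. Equality of the sums forces equality in each term, hence
  \<open>t i = 1\<close> throughout.\<close>

lemma power_mean_powr:
  fixes b :: "'i \<Rightarrow> real"
  assumes "finite I" "I \<noteq> {}" "1 < c" and nn: "\<And>i. i \<in> I \<Longrightarrow> 0 \<le> b i"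
  shows "(\<Sum>i\<in>I. b i) powr c \<le> real (card I) powr (c - 1) * (\<Sum>i\<in>I. b i powr c)"
    and "(\<Sum>i\<in>I. b i) powr c = real (card I) powr (c - 1) * (\<Sum>i\<in>I. b i powr c)
      \<longleftrightarrow> (\<forall>i\<in>I. \<forall>j\<in>I. b i = b j)"
proof -
  let ?N = "real (card I)" and ?S = "\<Sum>i\<in>I. b i"
  have N: "0 < ?N" using assms by (simp add: card_gt_0_iff)
  have main: "?S powr c \<le> ?N powr (c - 1) * (\<Sum>i\<in>I. b i powr c) \<and>
    (?S powr c = ?N powr (c - 1) * (\<Sum>i\<in>I. b i powr c) \<longleftrightarrow> (\<forall>i\<in>I. \<forall>j\<in>I. b i = b j))"
  proof (cases "?S = 0")
    case True
    then have "\<forall>i\<in>I. b i = 0" using assms by (simp add: sum_nonneg_eq_0_iff)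
    then show ?thesis using True by simp
  next
    case False
    then have S: "0 < ?S" using nn by (simp add: order_less_le sum_nonneg)
    define \<mu> where "\<mu> = ?S / ?N"
    have \<mu>: "0 < \<mu>" using S N by (simp add: \<mu>_def)
    define t where "t i = b i / \<mu>" for i
    have t: "0 \<le> t i" if "i \<in> I" for i using nn[OF that] \<mu> by (simp add: t_def)
    have bt: "b i powr c = \<mu> powr c * t i powr c" if "i \<in> I" for i
      using nn[OF that] \<mu> by (simp add: t_def powr_divide)
    have "(\<Sum>i\<in>I. t i) = ?S / \<mu>" by (simp add: t_def sum_divide_distrib)
    then have st: "(\<Sum>i\<in>I. t i) = ?N" using S by (simp add: \<mu>_def)
    have lin: "(\<Sum>i\<in>I. 1 + c * (t i - 1)) = ?N"
      using st by (simp add: sum.distrib sum_subtractf flip: sum_distrib_left)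
    have tan: "1 + c * (t i - 1) \<le> t i powr c" if "i \<in> I" for i
      using powr_tangent_one(1)[OF \<open>1 < c\<close> t[OF that]] .
    have ge: "?N \<le> (\<Sum>i\<in>I. t i powr c)"
      unfolding lin[symmetric] by (rule sum_mono) (rule tan)
    have "(\<Sum>i\<in>I. t i powr c) = ?N \<longleftrightarrow> (\<Sum>i\<in>I. t i powr c - (1 + c * (t i - 1))) = 0"
      unfolding sum_subtractf lin by simp
    also have "\<dots> \<longleftrightarrow> (\<forall>i\<in>I. t i powr c - (1 + c * (t i - 1)) = 0)"
      using tan by (intro sum_nonneg_eq_0_iff) (auto simp: assms)
    also have "\<dots> \<longleftrightarrow> (\<forall>i\<in>I. t i = 1)"
      using powr_tangent_one(2)[OF \<open>1 < c\<close> t] by simp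
    also have "\<dots> \<longleftrightarrow> (\<forall>i\<in>I. b i = \<mu>)" using \<mu> by (auto simp: t_def)
    also have "\<dots> \<longleftrightarrow> (\<forall>i\<in>I. \<forall>j\<in>I. b i = b j)"
    proof
      assume eq: "\<forall>i\<in>I. \<forall>j\<in>I. b i = b j"
      show "\<forall>i\<in>I. b i = \<mu>"
      proof
        fix i assume i: "i \<in> I"
        have "?S = (\<Sum>j\<in>I. b i)" using eq i by (intro sum.cong refl) blast
        then show "b i = \<mu>" using N by (simp add: \<mu>_def)
      qed
    qed simp
    finally have eq: "(\<Sum>i\<in>I. t i powr c) = ?N \<longleftrightarrow> (\<forall>i\<in>I. \<forall>j\<in>I. b i = b j)" .
    have sb: "(\<Sum>i\<in>I. b i powr c) = \<mu> powr c * (\<Sum>i\<in>I. t i powr c)"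
      using bt by (simp add: sum_distrib_left)
    have "?S powr c = (?N * \<mu>) powr c" using N by (simp add: \<mu>_def)
    also have "\<dots> = ?N powr c * \<mu> powr c" using N \<mu> by (simp add: powr_mult)
    also have "?N powr c = ?N powr (c - 1) * ?N" using N by (simp add: powr_diff)
    finally have sN: "?S powr c = ?N powr (c - 1) * \<mu> powr c * ?N" by simp
    have pos: "0 < ?N powr (c - 1) * \<mu> powr c" using N \<mu> by simp
    show ?thesis
      unfolding sb sN mult.assoc[symmetric] mult_le_cancel_left_pos[OF pos] eq[symmetric]
      using ge pos by auto
  qed
  show "?S powr c \<le> ?N powr (c - 1) * (\<Sum>i\<in>I. b i powr c)"
    by (rule main[THEN conjunct1])
  show "?S powr c = ?N powr (c - 1) * (\<Sum>i\<in>I. b i powr c) \<longleftrightarrow> (\<forall>i\<in>I. \<forall>j\<in>I. b i = b j)"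
    by (rule main[THEN conjunct2])
qed

text \<open>Each b^c splits as b^(c-1) * b, and no b exceeds the sum S, so it is at most S^(c-1) *
  b; these bounds add up to S^c. Termwise equality leaves only the values 0 and S, and for S > 0 two
  different indices cannot both carry S.\<close>

lemma sum_powr_superadditive:
  fixes b :: "'i \<Rightarrow> real"
  assumes fin: "finite I" and "1 < c" and nn: "\<And>i. i \<in> I \<Longrightarrow> 0 \<le> b i"
  shows "(\<Sum>i\<in>I. b i powr c) \<le> (\<Sum>i\<in>I. b i) powr c"
    and "(\<Sum>i\<in>I. b i powr c) = (\<Sum>i\<in>I. b i) powr c
      \<longleftrightarrow> (\<forall>i\<in>I. \<forall>j\<in>I. b i \<noteq> 0 \<and> b j \<noteq> 0 \<longrightarrow> i = j)"
proof -
  let ?S = "\<Sum>i\<in>I. b i"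
  have "(\<Sum>i\<in>I. b i powr c) \<le> ?S powr c \<and> ((\<Sum>i\<in>I. b i powr c) = ?S powr c
      \<longleftrightarrow> (\<forall>i\<in>I. \<forall>j\<in>I. b i \<noteq> 0 \<and> b j \<noteq> 0 \<longrightarrow> i = j))"
  proof (cases "?S = 0")
    case True
    then have "\<forall>i\<in>I. b i = 0" using assms by (simp add: sum_nonneg_eq_0_iff)
    then show ?thesis using True by simp
  next
    case False
    then have S: "0 < ?S" using nn by (simp add: order_less_le sum_nonneg)
    have le: "b i \<le> ?S" if "i \<in> I" for i
      using member_le_sum[of i I b] nn fin that by auto
    have key: "b i powr c \<le> ?S powr (c - 1) * b i"
      "b i powr c = ?S powr (c - 1) * b i \<longleftrightarrow> b i = 0 \<or> b i = ?S" if i: "i \<in> I" for i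
    proof -
      have *: "b i powr c < ?S powr (c - 1) * b i" if "b i \<noteq> 0" "b i \<noteq> ?S"
      proof -
        have "b i powr (c - 1) < ?S powr (c - 1)"
          using that le[OF i] nn[OF i] assms by (intro powr_less_mono2) auto
        then have "b i powr (c - 1) * b i < ?S powr (c - 1) * b i"
          using that nn[OF i] by simp
        moreover have "b i powr (c - 1) * b i = b i powr c"
          using that nn[OF i] by (simp add: powr_diff)
        ultimately show ?thesis by simp
      qed
      have "?S powr (c - 1) * ?S = ?S powr c" using S by (simp add: powr_diff)
      then show "b i powr c \<le> ?S powr (c - 1) * b i"
        "b i powr c = ?S powr (c - 1) * b i \<longleftrightarrow> b i = 0 \<or> b i = ?S"
        using * by (cases "b i = 0 \<or> b i = ?S"; force)+
    qed
    have "?S powr c = ?S powr (c - 1) * ?S" using S by (simp add: powr_diff)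
    then have Sc: "?S powr c = (\<Sum>i\<in>I. ?S powr (c - 1) * b i)"
      by (simp add: sum_distrib_left)
    have "(\<Sum>i\<in>I. b i powr c) \<le> ?S powr c"
      unfolding Sc by (rule sum_mono) (rule key)
    moreover have "(\<Sum>i\<in>I. b i powr c) = ?S powr c
      \<longleftrightarrow> (\<Sum>i\<in>I. ?S powr (c - 1) * b i - b i powr c) = 0"
      unfolding Sc sum_subtractf by auto
    moreover have "\<dots> \<longleftrightarrow> (\<forall>i\<in>I. ?S powr (c - 1) * b i - b i powr c = 0)"
      using key(1) by (intro sum_nonneg_eq_0_iff) (auto simp: fin)
    moreover have "\<dots> \<longleftrightarrow> (\<forall>i\<in>I. b i = 0 \<or> b i = ?S)"
      using key(2) by (metis eq_iff_diff_eq_0)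
    moreover have "\<dots> \<longleftrightarrow> (\<forall>i\<in>I. \<forall>j\<in>I. b i \<noteq> 0 \<and> b j \<noteq> 0 \<longrightarrow> i = j)"
    proof
      assume *: "\<forall>i\<in>I. b i = 0 \<or> b i = ?S"
      show "\<forall>i\<in>I. \<forall>j\<in>I. b i \<noteq> 0 \<and> b j \<noteq> 0 \<longrightarrow> i = j"
      proof (intro ballI impI, rule ccontr)
        fix i j assume ij: "i \<in> I" "j \<in> I" "b i \<noteq> 0 \<and> b j \<noteq> 0" "i \<noteq> j"
        have "(\<Sum>k\<in>{i,j}. b k) \<le> ?S" using ij nn fin by (intro sum_mono2) auto
        moreover have "b i = ?S" "b j = ?S" using ij * by auto
        ultimately show False using ij(4) S by simp
      qed
    next
      assume *: "\<forall>i\<in>I. \<forall>j\<in>I. b i \<noteq> 0 \<and> b j \<noteq> 0 \<longrightarrow> i = j"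
      show "\<forall>i\<in>I. b i = 0 \<or> b i = ?S"
      proof
        fix i assume i: "i \<in> I"
        have "?S = b i" if "b i \<noteq> 0"
        proof -
          have "?S = (\<Sum>k\<in>{i}. b k)"
            using * i that fin by (intro sum.mono_neutral_right) auto
          then show ?thesis by simp
        qed
        then show "b i = 0 \<or> b i = ?S" by metis
      qed
    qed
    ultimately show ?thesis by simp
  qed
  then show "(\<Sum>i\<in>I. b i powr c) \<le> ?S powr c"
    and "(\<Sum>i\<in>I. b i powr c) = ?S powr c
      \<longleftrightarrow> (\<forall>i\<in>I. \<forall>j\<in>I. b i \<noteq> 0 \<and> b j \<noteq> 0 \<longrightarrow> i = j)" by auto
qed

lemma powr_eq_iff_nonneg:
  fixes x y a :: real
  assumes "0 \<le> x" "0 \<le> y" "0 < a"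
  shows "x powr a = y powr a \<longleftrightarrow> x = y"
  using powr_less_mono2[of a x y] powr_less_mono2[of a y x] assms by (cases x y rule: linorder_cases) auto

section \<open>Comparing two exponents: the norms decrease in p, and increase at most by a power of
  the dimension\<close>

lemma pnorm_ereal:
  "0 < p \<Longrightarrow> pnorm (ereal p) v = (\<Sum>i<dim_vec v. norm (v $ i) powr p) powr (1 / p)"
  by (simp add: pnorm_def)

lemma pnorm_infty:
  assumes "v \<in> carrier_vec n" "0 < n"
  obtains j where "j < n" "pnorm \<infinity> v = norm (v $ j)" "\<And>i. i < n \<Longrightarrow> norm (v $ i) \<le> norm (v $ j)"
proof -
  have d: "dim_vec v = n" using assms by auto
  let ?M = "{norm (v $ i) | i. i < n}"
  have f: "finite ?M" by auto
  moreover have "?M \<noteq> {}" using assms by auto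
  ultimately have "Max ?M \<in> ?M" by (rule Max_in)
  then obtain j where j: "j < n" "Max ?M = norm (v $ j)" by auto
  have "norm (v $ i) \<le> norm (v $ j)" if "i < n" for i
    unfolding j(2)[symmetric] using f that by (intro Max_ge) auto
  then show thesis using that j d assms by (auto simp: pnorm_def)
qed

lemma pnorm_nonneg: "0 < n \<Longrightarrow> v \<in> carrier_vec n \<Longrightarrow> 0 \<le> pnorm p v"
  by (cases "p = \<infinity>") (metis norm_ge_zero pnorm_infty, simp add: pnorm_def)

text \<open>For finite q this is superadditivity of the power c = q/p, applied to the numbers |v
  i|^p and with both sides put under the root of order q. For q = \<infinity> the largest entry is
  one summand of the p-sum, and equality says that the others contribute nothing.\<close>

lemma pnorm_antimono:
  fixes v :: "'a::real_normed_field vec"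
  assumes n: "0 < n" and v: "v \<in> carrier_vec n" and "1 \<le> p" "p < q"
  shows "pnorm q v \<le> pnorm p v" and "pnorm q v = pnorm p v \<longleftrightarrow> v \<in> Kset (-1) n"
proof -
  have d: "dim_vec v = n" using v by auto
  obtain p' where p: "p = ereal p'" "1 \<le> p'" using assms by (cases p) auto
  let ?S = "\<Sum>i<n. norm (v $ i) powr p'"
  have S: "0 \<le> ?S" by (simp add: sum_nonneg)
  have pp: "pnorm p v = ?S powr (1 / p')" using p d by (simp add: pnorm_ereal)
  have K: "v \<in> Kset (-1) n \<longleftrightarrow>
      (\<forall>i\<in>{..<n}. \<forall>j\<in>{..<n}. norm (v $ i) powr p' \<noteq> 0 \<and> norm (v $ j) powr p' \<noteq> 0 \<longrightarrow> i = j)"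
    using v by (auto simp: Kset_def)
  have "pnorm q v \<le> pnorm p v \<and> (pnorm q v = pnorm p v \<longleftrightarrow> v \<in> Kset (-1) n)"
  proof (cases q)
    case (real q')
    then have q: "p' < q'" "0 < q'" using p assms by auto
    define c where "c = q' / p'"
    have c: "1 < c" using q p by (simp add: c_def)
    have b: "(norm (v $ i) powr p') powr c = norm (v $ i) powr q'" for i
      using p by (simp add: powr_powr c_def)
    have qq: "pnorm q v = (\<Sum>i<n. (norm (v $ i) powr p') powr c) powr (1 / q')"
      using real q d by (simp add: pnorm_ereal b)
    have ps: "pnorm p v = (?S powr c) powr (1 / q')"
      unfolding pp powr_powr using q by (simp add: c_def)
    have nn: "0 \<le> (\<Sum>i<n. (norm (v $ i) powr p') powr c)" by (simp add: sum_nonneg)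
    note sup = sum_powr_superadditive[of "{..<n}" c "\<lambda>i. norm (v $ i) powr p'", OF _ c]
    have "pnorm q v \<le> pnorm p v" unfolding qq ps
      using sup(1) q nn by (intro powr_mono2) auto
    moreover have "pnorm q v = pnorm p v \<longleftrightarrow> v \<in> Kset (-1) n"
      unfolding qq ps K using sup(2) q nn by (subst powr_eq_iff_nonneg) auto
    ultimately show ?thesis ..
  next
    case PInf
    obtain j where j: "j < n" "pnorm q v = norm (v $ j)" "\<And>i. i < n \<Longrightarrow> norm (v $ i) \<le> norm (v $ j)"
      using pnorm_infty[OF v n] PInf by auto
    have qj: "pnorm q v = (norm (v $ j) powr p') powr (1 / p')" using j p by (simp add: powr_powr)
    have le: "norm (v $ j) powr p' \<le> ?S" using j by (intro member_le_sum) auto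
    have "?S = norm (v $ j) powr p' + (\<Sum>i\<in>{..<n}-{j}. norm (v $ i) powr p')"
      using j by (intro sum.remove) auto
    then have "norm (v $ j) powr p' = ?S \<longleftrightarrow> (\<Sum>i\<in>{..<n}-{j}. norm (v $ i) powr p') = 0" by auto
    also have "\<dots> \<longleftrightarrow> (\<forall>i\<in>{..<n}-{j}. norm (v $ i) powr p' = 0)"
      by (intro sum_nonneg_eq_0_iff) auto
    also have "\<dots> \<longleftrightarrow> v \<in> Kset (-1) n"
    proof
      assume *: "\<forall>i\<in>{..<n}-{j}. norm (v $ i) powr p' = 0"
      then have "i = j" if "v $ i \<noteq> 0" "i < n" for i using that by auto
      then show "v \<in> Kset (-1) n" using v unfolding Kset_def by auto
    next
      assume *: "v \<in> Kset (-1) n"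
      show "\<forall>i\<in>{..<n}-{j}. norm (v $ i) powr p' = 0"
      proof
        fix i assume i: "i \<in> {..<n}-{j}"
        have "v $ i = 0"
        proof (rule ccontr)
          \<comment> \<open>Entry j has the largest modulus, so a nonzero entry elsewhere would make
            j a second nonzero position.\<close>
          assume "v $ i \<noteq> 0"
          moreover from this have "v $ j \<noteq> 0" using j(3)[of i] i by auto
          ultimately show False using * i j by (auto simp: Kset_def)
        qed
        then show "norm (v $ i) powr p' = 0" by simp
      qed
    qed
    finally have eq: "norm (v $ j) powr p' = ?S \<longleftrightarrow> v \<in> Kset (-1) n" .
    have "pnorm q v \<le> pnorm p v" unfolding qj pp using le p by (intro powr_mono2) auto
    moreover have "pnorm q v = pnorm p v \<longleftrightarrow> v \<in> Kset (-1) n"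
      unfolding qj pp eq[symmetric] using p S by (subst powr_eq_iff_nonneg) auto
    ultimately show ?thesis ..
  qed (use assms in auto)
  then show "pnorm q v \<le> pnorm p v" and "pnorm q v = pnorm p v \<longleftrightarrow> v \<in> Kset (-1) n" by auto
qed

text \<open>For finite q this is the power mean inequality with c = q/p for the numbers |v i|^p. For
  q = \<infinity>, where 1/q = 0, every entry is bounded by the largest one.\<close>

lemma pnorm_le_powr_mult_pnorm:
  fixes v :: "'a::real_normed_field vec"
  assumes n: "0 < n" and v: "v \<in> carrier_vec n" and "1 \<le> p" "p < q"
  shows "pnorm p v \<le> real n powr (real_of_ereal (1 / p) - real_of_ereal (1 / q)) * pnorm q v"
    and "pnorm p v = real n powr (real_of_ereal (1 / p) - real_of_ereal (1 / q)) * pnorm q v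
      \<longleftrightarrow> v \<in> Kset 1 n"
proof -
  have d: "dim_vec v = n" using v by auto
  obtain p' where p: "p = ereal p'" "1 \<le> p'" using assms by (cases p) auto
  have ip: "real_of_ereal (1 / p) = 1 / p'" using p by (simp add: one_ereal_def)
  let ?S = "\<Sum>i<n. norm (v $ i) powr p'"
  have S: "0 \<le> ?S" by (simp add: sum_nonneg)
  have pp: "pnorm p v = ?S powr (1 / p')" using p d by (simp add: pnorm_ereal)
  have K: "v \<in> Kset 1 n \<longleftrightarrow>
      (\<forall>i\<in>{..<n}. \<forall>j\<in>{..<n}. norm (v $ i) powr p' = norm (v $ j) powr p')"
    using v p by (auto simp: Kset_def powr_eq_iff_nonneg)
  let ?e = "real_of_ereal (1 / p) - real_of_ereal (1 / q)"
  have "pnorm p v \<le> real n powr ?e * pnorm q v \<and> (pnorm p v = real n powr ?e * pnorm q v \<longleftrightarrow> v \<in> Kset 1 n)"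
  proof (cases q)
    case (real q')
    then have q: "p' < q'" "0 < q'" using p assms by auto
    have iq: "real_of_ereal (1 / q) = 1 / q'" using real q by (simp add: one_ereal_def)
    define c where "c = q' / p'"
    have c: "1 < c" using q p by (simp add: c_def)
    have b: "(norm (v $ i) powr p') powr c = norm (v $ i) powr q'" for i
      using p by (simp add: powr_powr c_def)
    let ?T = "\<Sum>i<n. (norm (v $ i) powr p') powr c"
    have nn: "0 \<le> ?T" by (simp add: sum_nonneg)
    \<comment> \<open>The exponent 1/p - 1/q of the constant arises here: it is the root of order q
      of the power mean factor n^(c-1).\<close>
    have "(c - 1) * (1 / q') = ?e" unfolding ip iq c_def using p q by (simp add: field_simps)
    then have "real n powr ?e = (real n powr (c - 1)) powr (1 / q')" by (simp add: powr_powr)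
    then have qq: "real n powr ?e * pnorm q v = (real n powr (c - 1) * ?T) powr (1 / q')"
      using real q d nn by (simp add: pnorm_ereal b powr_mult)
    have ps: "pnorm p v = (?S powr c) powr (1 / q')"
      unfolding pp powr_powr using q by (simp add: c_def)
    have "{..<n} \<noteq> {}" using n by auto
    note mean = power_mean_powr[of "{..<n}" c "\<lambda>i. norm (v $ i) powr p'",
        OF finite_lessThan this c powr_ge_zero, unfolded card_lessThan]
    have "pnorm p v \<le> real n powr ?e * pnorm q v" unfolding qq ps
      using mean(1) q n by (intro powr_mono2) auto
    moreover have "pnorm p v = real n powr ?e * pnorm q v \<longleftrightarrow> v \<in> Kset 1 n"
      unfolding qq ps K mean(2)[symmetric] using q nn by (subst powr_eq_iff_nonneg) auto
    ultimately show ?thesis ..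
  next
    case PInf
    obtain j where j: "j < n" "pnorm q v = norm (v $ j)" "\<And>i. i < n \<Longrightarrow> norm (v $ i) \<le> norm (v $ j)"
      using pnorm_infty[OF v n] PInf by auto
    \<comment> \<open>The right side of the bound is rewritten as the p-norm of a vector all of
      whose entries have the maximal modulus, so that the two sums can be compared term by
      term.\<close>
    have qj: "real n powr ?e * pnorm q v = (\<Sum>i<n. norm (v $ j) powr p') powr (1 / p')"
      unfolding ip using j p PInf by (simp add: powr_powr powr_mult)
    have le: "norm (v $ i) powr p' \<le> norm (v $ j) powr p'" if "i < n" for i
      using j(3)[OF that] p by (intro powr_mono2) auto
    have "?S = (\<Sum>i<n. norm (v $ j) powr p') \<longleftrightarrow> (\<Sum>i<n. norm (v $ j) powr p' - norm (v $ i) powr p') = 0"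
      unfolding sum_subtractf by auto
    also have "\<dots> \<longleftrightarrow> (\<forall>i\<in>{..<n}. norm (v $ j) powr p' - norm (v $ i) powr p' = 0)"
      using le by (intro sum_nonneg_eq_0_iff) auto
    also have "\<dots> \<longleftrightarrow> v \<in> Kset 1 n" unfolding K using j(1) by (metis eq_iff_diff_eq_0 lessThan_iff)
    finally have eq: "?S = (\<Sum>i<n. norm (v $ j) powr p') \<longleftrightarrow> v \<in> Kset 1 n" .
    have "pnorm p v \<le> real n powr ?e * pnorm q v" unfolding qj pp
      using j(3) p S by (intro powr_mono2 sum_mono) auto
    moreover have "pnorm p v = real n powr ?e * pnorm q v \<longleftrightarrow> v \<in> Kset 1 n"
      unfolding qj pp eq[symmetric] using p S by (subst powr_eq_iff_nonneg) (auto intro: sum_nonneg)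
    ultimately show ?thesis ..
  qed (use assms in auto)
  then show "pnorm p v \<le> real n powr ?e * pnorm q v"
    and "pnorm p v = real n powr ?e * pnorm q v \<longleftrightarrow> v \<in> Kset 1 n" by auto
qed

section \<open>Inner products over the real and complex numbers\<close>

text \<open>The common interface of the two fields. The first axiom ties the conjugation to the
  norm, so that the inner product of a vector with itself is its squared length; the second is the
  source of the maximizers.\<close>

class real_or_complex = conjugatable_field + real_normed_field +
  assumes mult_conjugate_scaleR: "x * conjugate x = (norm x)\<^sup>2 *\<^sub>R 1"
    and compact_norm_le_1: "compact {x. norm x \<le> 1}"

instance real :: real_or_complex
proof
  show "x * conjugate x = (norm x)\<^sup>2 *\<^sub>R 1" for x :: real
    by (simp add: power2_eq_square)
  have "{x::real. norm x \<le> 1} = {-1..1}" by auto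
  then show "compact {x::real. norm x \<le> 1}" by simp
qed

instance complex :: real_or_complex
proof
  show "x * conjugate x = (norm x)\<^sup>2 *\<^sub>R 1" for x :: complex
    by (simp add: complex_norm_square scaleR_conv_of_real del: of_real_power)
next
  let ?f = "\<lambda>p. Complex (fst p) (snd p)"
  \<comment> \<open>The unit disc is a closed subset of a square, and the square is a continuous
    image of a product of compact intervals.\<close>
  have "continuous_on ({-1..1} \<times> {-1..1}) ?f"
    unfolding Complex_eq by (intro continuous_intros)
  then have "compact (?f ` ({-1..1} \<times> {-1..1}))"
    by (rule compact_continuous_image) (intro compact_Times compact_Icc)
  moreover have "{x. norm x \<le> 1} \<subseteq> ?f ` ({-1..1} \<times> {-1..1})"
  proof
    fix z :: complex assume "z \<in> {x. norm x \<le> 1}"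
    then have "\<bar>Re z\<bar> \<le> 1" "\<bar>Im z\<bar> \<le> 1"
      using abs_Re_le_cmod[of z] abs_Im_le_cmod[of z] by auto
    then show "z \<in> ?f ` ({-1..1} \<times> {-1..1})"
      by (intro image_eqI[of _ _ "(Re z, Im z)"]) auto
  qed
  moreover have "closed {x::complex. norm x \<le> 1}"
    by (intro closed_Collect_le continuous_intros)
  ultimately show "compact {x::complex. norm x \<le> 1}"
    by (metis compact_Int_closed inf.absorb_iff2)
qed

lemma mult_conjugate: "x * conjugate x = of_real ((norm (x::'a::real_or_complex))\<^sup>2)"
  by (simp only: mult_conjugate_scaleR scaleR_conv_of_real mult_1_right)

lemma norm_conjugate [simp]: "norm (conjugate x) = norm (x::'a::real_or_complex)"
proof (cases "x = 0")
  case False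
  have "norm (x * conjugate x) = norm x * norm x"
    unfolding mult_conjugate norm_of_real by (simp add: power2_eq_square)
  then show ?thesis using False by (simp add: norm_mult)
qed simp

lemma conjugate_one [simp]: "conjugate (1::'a::conjugatable_field) = 1"
proof -
  have "conjugate (1::'a) * conjugate 1 = conjugate 1 * 1"
    by (simp flip: conjugate_dist_mul)
  then show ?thesis by simp
qed

text \<open>A real t \<ge> 0 has the form y * conjugate y with y the square root of t, and such a
  product is its own conjugate. Negative reals follow by a change of sign.\<close>

lemma conjugate_of_real [simp]:
  "conjugate (of_real t :: 'a::real_or_complex) = of_real t"
proof -
  have *: "conjugate (of_real t :: 'a) = of_real t" if "0 \<le> t" for t
  proof -
    let ?y = "of_real (sqrt t) :: 'a"
    have t: "of_real t = ?y * conjugate ?y" unfolding mult_conjugate using that by simp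
    show ?thesis unfolding t by (simp add: conjugate_dist_mul mult.commute)
  qed
  show ?thesis
    using *[of t] *[of "-t"] by (cases "0 \<le> t") (auto simp: conjugate_neg)
qed

section \<open>The Euclidean norm, the inner product, and attained maxima\<close>

definition l2norm :: "'a::real_normed_vector vec \<Rightarrow> real" where
  "l2norm v = sqrt (\<Sum>i<dim_vec v. (norm (v $ i))\<^sup>2)"

lemma pnorm_2: "pnorm 2 v = l2norm v"
proof -
  have "pnorm 2 v = pnorm (ereal 2) v" by simp
  also have "\<dots> = (\<Sum>i<dim_vec v. norm (v $ i) powr 2) powr (1 / 2)"
    by (rule pnorm_ereal) simp
  also have "\<dots> = l2norm v"
    by (simp add: powr_half_sqrt sum_nonneg l2norm_def)
  finally show ?thesis .
qed

lemma l2norm_nonneg [simp]: "0 \<le> l2norm v"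
  by (simp add: l2norm_def sum_nonneg)

lemma l2norm_sq: "(l2norm v)\<^sup>2 = (\<Sum>i<dim_vec v. (norm (v $ i))\<^sup>2)"
  by (simp add: l2norm_def sum_nonneg)

lemma pnorm_eq_0_iff:
  fixes v :: "'a::real_normed_field vec"
  assumes n: "0 < n" and v: "v \<in> carrier_vec n" and p: "1 \<le> p"
  shows "pnorm p v = 0 \<longleftrightarrow> v = 0\<^sub>v n"
proof (cases p)
  case (real p')
  then have "pnorm p v = 0 \<longleftrightarrow> (\<Sum>i<n. norm (v $ i) powr p') = 0"
    using p v by (simp add: pnorm_ereal)
  also have "\<dots> \<longleftrightarrow> (\<forall>i<n. v $ i = 0)"
    by (subst sum_nonneg_eq_0_iff) auto
  finally show ?thesis using v by (auto intro!: eq_vecI)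
next
  case PInf
  obtain j where j: "j < n" "pnorm p v = norm (v $ j)" "\<And>i. i < n \<Longrightarrow> norm (v $ i) \<le> norm (v $ j)"
    using pnorm_infty[OF v n] PInf by auto
  then have "pnorm p v = 0 \<longleftrightarrow> (\<forall>i<n. v $ i = 0)"
    by (metis norm_eq_zero norm_le_zero_iff)
  then show ?thesis using v by (auto intro!: eq_vecI)
qed (use p in auto)

lemma pnorm_smult:
  fixes v :: "'a::real_normed_field vec"
  assumes n: "0 < n" and v: "v \<in> carrier_vec n" and p: "1 \<le> p"
  shows "pnorm p (c \<cdot>\<^sub>v v) = norm c * pnorm p v"
proof (cases p)
  case (real p')
  then have p': "1 \<le> p'" using p by simp
  have "pnorm p (c \<cdot>\<^sub>v v) = (norm c powr p' * (\<Sum>i<n. norm (v $ i) powr p')) powr (1 / p')"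
    using real p' v by (simp add: pnorm_ereal norm_mult powr_mult sum_distrib_left)
  also have "\<dots> = norm c * pnorm p v"
    using real p' v by (simp add: pnorm_ereal powr_mult powr_powr sum_nonneg)
  finally show ?thesis .
next
  case PInf
  obtain j where j: "j < n" "pnorm p v = norm (v $ j)" "\<And>i. i < n \<Longrightarrow> norm (v $ i) \<le> norm (v $ j)"
    using pnorm_infty[OF v n] PInf by auto
  have cv: "c \<cdot>\<^sub>v v \<in> carrier_vec n" using v by simp
  obtain k where k: "k < n" "pnorm p (c \<cdot>\<^sub>v v) = norm ((c \<cdot>\<^sub>v v) $ k)"
    "\<And>i. i < n \<Longrightarrow> norm ((c \<cdot>\<^sub>v v) $ i) \<le> norm ((c \<cdot>\<^sub>v v) $ k)"
    using pnorm_infty[OF cv n] PInf by auto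
  have "norm ((c \<cdot>\<^sub>v v) $ k) \<le> norm c * norm (v $ j)"
    using j k(1) v by (auto simp: norm_mult intro: mult_left_mono)
  moreover have "norm c * norm (v $ j) \<le> norm ((c \<cdot>\<^sub>v v) $ k)"
    using k(3)[OF j(1)] j(1) v by (simp add: norm_mult)
  ultimately show ?thesis using j(2) k(2) by simp
qed (use p in auto)

lemma cscalar_prod_sum:
  "y \<in> carrier_vec n \<Longrightarrow> x \<bullet>c y = (\<Sum>i<n. x $ i * conjugate (y $ i))"
  by (auto simp: scalar_prod_def atLeast0LessThan intro!: sum.cong)

lemma cscalar_prod_self:
  fixes x :: "'a::real_or_complex vec"
  shows "x \<bullet>c x = of_real ((l2norm x)\<^sup>2)"
  by (simp add: cscalar_prod_sum[of _ "dim_vec x"] mult_conjugate l2norm_sq del: of_real_power)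

lemma conjugate_cscalar_prod:
  fixes x y :: "'a::conjugatable_field vec"
  assumes "x \<in> carrier_vec n" "y \<in> carrier_vec n"
  shows "conjugate (x \<bullet>c y) = y \<bullet>c x"
  using assms by (simp add: cscalar_prod_sum sum_conjugate conjugate_dist_mul mult.commute)

lemma cscalar_prod_Cauchy_Schwarz:
  fixes x y :: "'a::real_or_complex vec"
  assumes "x \<in> carrier_vec n" "y \<in> carrier_vec n"
  shows "norm (x \<bullet>c y) \<le> l2norm x * l2norm y"
proof -
  have "norm (x \<bullet>c y) \<le> (\<Sum>i<n. norm (x $ i) * norm (y $ i))"
    unfolding cscalar_prod_sum[OF assms(2)] by (rule sum_norm_le) (simp add: norm_mult)
  also have "\<dots> \<le> L2_set (\<lambda>i. norm (x $ i)) {..<n} * L2_set (\<lambda>i. norm (y $ i)) {..<n}"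
    using L2_set_mult_ineq[of "\<lambda>i. norm (x $ i)" "\<lambda>i. norm (y $ i)" "{..<n}"] by simp
  finally show ?thesis using assms by (simp add: L2_set_def l2norm_def)
qed

lemma adjoint_mat_carrier [simp]: "A \<in> carrier_mat n m \<Longrightarrow> adjoint_mat A \<in> carrier_mat m n"
  by (auto simp: adjoint_mat_def)

lemma cscalar_prod_adjoint_mat:
  fixes A :: "'a::conjugatable_field mat"
  assumes A: "A \<in> carrier_mat n m" and x: "x \<in> carrier_vec m" and y: "y \<in> carrier_vec n"
  shows "(A *\<^sub>v x) \<bullet>c y = x \<bullet>c (adjoint_mat A *\<^sub>v y)"
proof -
  have Ax: "(A *\<^sub>v x) $ i = (\<Sum>j<m. A $$ (i,j) * x $ j)" if "i < n" for i
    using that A x by (auto simp: scalar_prod_def atLeast0LessThan intro!: sum.cong)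
  have Ay: "(adjoint_mat A *\<^sub>v y) $ j = (\<Sum>i<n. conjugate (A $$ (i,j)) * y $ i)" if "j < m" for j
    using that A y by (auto simp: adjoint_mat_def scalar_prod_def atLeast0LessThan intro!: sum.cong)
  have "(A *\<^sub>v x) \<bullet>c y = (\<Sum>i<n. \<Sum>j<m. A $$ (i,j) * x $ j * conjugate (y $ i))"
    using y by (simp add: cscalar_prod_sum Ax sum_distrib_right)
  also have "\<dots> = (\<Sum>j<m. \<Sum>i<n. A $$ (i,j) * x $ j * conjugate (y $ i))"
    by (rule sum.swap)
  also have "\<dots> = x \<bullet>c (adjoint_mat A *\<^sub>v y)"
    unfolding cscalar_prod_sum[OF mult_mat_vec_carrier[OF adjoint_mat_carrier[OF A] y]]
    by (intro sum.cong refl)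
      (simp add: Ay sum_conjugate conjugate_dist_mul sum_distrib_left mult_ac)
  finally show ?thesis .
qed

text \<open>Phrased through continuous coordinate functions \<open>h\<close>, so that it covers both
  \<open>vec m g\<close> and its image under a matrix, whose coordinates are finite sums.\<close>

lemma continuous_on_pnorm:
  fixes h :: "'b::topological_space \<Rightarrow> nat \<Rightarrow> 'a::real_normed_field"
  assumes n: "0 < n" and p: "1 \<le> p" and h: "\<And>i. i < n \<Longrightarrow> continuous_on S (\<lambda>g. h g i)"
  shows "continuous_on S (\<lambda>g. pnorm p (vec n (h g)))"
proof (cases p)
  case (real p')
  then have p': "1 \<le> p'" using p by simp
  have eq: "pnorm p (vec n (h g)) = (\<Sum>i<n. norm (h g i) powr p') powr (1 / p')" for g
    using real p' by (simp add: pnorm_ereal)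
  show ?thesis unfolding eq
    using p' h by (intro continuous_on_powr' continuous_on_sum continuous_on_norm continuous_on_const)
      (auto intro: sum_nonneg)
next
  case PInf
  \<comment> \<open>The maximum is assembled from the binary \<open>max\<close>, one coordinate at a
    time; ranging over \<open>{..<Suc k}\<close> keeps the set nonempty.\<close>
  have Max: "continuous_on S (\<lambda>g. Max ((\<lambda>i. norm (h g i)) ` {..<Suc k}))" if "Suc k \<le> n" for k
    using that
  proof (induction k)
    case 0
    then show ?case using h by (simp add: lessThan_Suc continuous_on_norm)
  next
    case (Suc k)
    have "continuous_on S (\<lambda>g. max (norm (h g (Suc k))) (Max ((\<lambda>i. norm (h g i)) ` {..<Suc k})))"
      using Suc h by (intro continuous_on_max continuous_on_norm) auto
    then show ?case by (subst lessThan_Suc) (simp add: Max_insert lessThan_Suc)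
  qed
  obtain k where k: "n = Suc k" using n by (cases n) auto
  have eq: "pnorm p (vec n (h g)) = Max ((\<lambda>i. norm (h g i)) ` {..<n})" for g
  proof -
    have "{norm (vec n (h g) $ i) | i. i < n} = (\<lambda>i. norm (vec n (h g) $ i)) ` {..<n}"
      by (simp only: setcompr_eq_image lessThan_def)
    also have "\<dots> = (\<lambda>i. norm (h g i)) ` {..<n}" by (intro image_cong) auto
    finally have "{norm (vec n (h g) $ i) | i. i < n} = (\<lambda>i. norm (h g i)) ` {..<n}" .
    then show ?thesis using PInf n by (simp add: pnorm_def)
  qed
  show ?thesis unfolding eq unfolding k by (rule Max) (simp add: k)
qed (use p in auto)

text \<open>The unit sphere of the orthogonal complement of \<open>W\<close>. Taking
  \<open>W = {}\<close> gives the whole sphere, on which general operator norms are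
  maximized.\<close>

definition unit_perp :: "nat \<Rightarrow> 'a::real_or_complex vec set \<Rightarrow> 'a vec set" where
  "unit_perp m W = {x \<in> carrier_vec m. l2norm x = 1 \<and> (\<forall>w\<in>W. x \<bullet>c w = 0)}"

text \<open>Vectors are parametrized by functions \<open>nat \<Rightarrow> 'a\<close>, so that
  compactness comes from Tychonoff's theorem. Continuity is required only on the sphere because
  \<open>f\<close> may be a quotient of norms, whose denominator vanishes at the origin.\<close>

lemma attains_max_on_unit_perp:
  fixes f :: "'a::real_or_complex vec \<Rightarrow> real"
  assumes m: "0 < m" and W: "W \<subseteq> carrier_vec m" and ne: "unit_perp m W \<noteq> {}"
    and f: "continuous_on {g. vec m g \<in> unit_perp m W} (\<lambda>g. f (vec m g))"
  shows "\<exists>x\<in>unit_perp m W. \<forall>y\<in>unit_perp m W. f y \<le> f x"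
proof -
  \<comment> \<open>\<open>vec m\<close> ignores the coordinates from \<open>m\<close> on. Fixing
    them to 0 keeps the product compact and loses no vector.\<close>
  define B where "B = PiE UNIV (\<lambda>i. if i < m then {x::'a. norm x \<le> 1} else {0})"
  define C where "C = {g::nat \<Rightarrow> 'a. l2norm (vec m g) = 1} \<inter> (\<Inter>w\<in>W. {g. vec m g \<bullet>c w = 0})"
  have "compactin (product_topology (\<lambda>i. euclidean) UNIV) B"
    unfolding B_def compactin_PiE by (simp add: compact_norm_le_1)
  then have B: "compact B"
    by (simp add: euclidean_product_topology)
  have "continuous_on UNIV (\<lambda>g::nat \<Rightarrow> 'a. l2norm (vec m g))"
    using continuous_on_pnorm[OF m, of 2 UNIV "\<lambda>g. g"] unfolding pnorm_2 by simp
  then have c1: "closed {g::nat \<Rightarrow> 'a. l2norm (vec m g) = 1}"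
    by (intro closed_Collect_eq) simp_all
  have c2: "closed {g::nat \<Rightarrow> 'a. vec m g \<bullet>c w = 0}" if "w \<in> W" for w
  proof -
    have w: "w \<in> carrier_vec m" using W that by auto
    show ?thesis unfolding cscalar_prod_sum[OF w]
      by (intro closed_Collect_eq) (auto intro!: continuous_intros)
  qed
  have "closed C" unfolding C_def using c1 c2 by (intro closed_Int closed_INT) auto
  then have BC: "compact (B \<inter> C)" using compact_Int_closed[OF B] by simp
  have CS: "g \<in> C \<longleftrightarrow> vec m g \<in> unit_perp m W" for g by (auto simp: C_def unit_perp_def)
  \<comment> \<open>Entries of a unit vector have modulus at most 1, so every point of the sphere
    has a representative in \<open>B\<close>.\<close>
  have rep: "\<exists>g\<in>B \<inter> C. vec m g = x" if x: "x \<in> unit_perp m W" for x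
  proof
    let ?g = "\<lambda>i. if i < m then x $ i else 0"
    have xm: "x \<in> carrier_vec m" using x by (simp add: unit_perp_def)
    show eq: "vec m ?g = x" using xm by (auto intro!: eq_vecI)
    have "norm (x $ i) \<le> 1" if "i < m" for i
    proof -
      have "(norm (x $ i))\<^sup>2 \<le> (\<Sum>i<m. (norm (x $ i))\<^sup>2)"
        using that by (intro member_le_sum) auto
      also have "\<dots> = (l2norm x)\<^sup>2" using xm by (simp add: l2norm_sq)
      also have "\<dots> = 1" using x by (simp add: unit_perp_def)
      finally show ?thesis by (simp add: power_le_one_iff abs_square_le_1)
    qed
    then show "?g \<in> B \<inter> C" using eq x by (auto simp: B_def CS)
  qed
  have "B \<inter> C \<noteq> {}" using ne rep by blast
  moreover have "continuous_on (B \<inter> C) (\<lambda>g. f (vec m g))"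
    using f by (rule continuous_on_subset) (auto simp: CS)
  ultimately obtain g where g: "g \<in> B \<inter> C" "\<And>h. h \<in> B \<inter> C \<Longrightarrow> f (vec m h) \<le> f (vec m g)"
    using continuous_attains_sup[OF BC] by blast
  show ?thesis
  proof (intro bexI ballI)
    show "vec m g \<in> unit_perp m W" using g CS by auto
    show "f y \<le> f (vec m g)" if "y \<in> unit_perp m W" for y
      using rep[OF that] g(2) by blast
  qed
qed

section \<open>Orthonormal systems and unitary matrices\<close>

lemma l2norm_eq_0_iff:
  "v \<in> carrier_vec n \<Longrightarrow> l2norm v = 0 \<longleftrightarrow> v = 0\<^sub>v n"
  by (auto simp: l2norm_def sum_nonneg_eq_0_iff intro!: eq_vecI)

lemma l2norm_smult:
  "l2norm (c \<cdot>\<^sub>v v) = norm c * l2norm (v :: 'a::real_normed_field vec)"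
  by (simp add: l2norm_def norm_mult power_mult_distrib real_sqrt_mult flip: sum_distrib_left)

lemma l2norm_eq_1_iff:
  "l2norm (x :: 'a::real_or_complex vec) = 1 \<longleftrightarrow> x \<bullet>c x = 1"
proof -
  have "x \<bullet>c x = 1 \<longleftrightarrow> (of_real ((l2norm x)\<^sup>2) :: 'a) = of_real 1"
    unfolding cscalar_prod_self by simp
  also have "\<dots> \<longleftrightarrow> (l2norm x)\<^sup>2 = 1" unfolding of_real_eq_iff ..
  also have "\<dots> \<longleftrightarrow> l2norm x = 1" using power2_eq_iff_nonneg[of "l2norm x" 1] by simp
  finally show ?thesis by simp
qed

lemma l2norm_normalize:
  fixes x :: "'a::real_or_complex vec"
  assumes "x \<in> carrier_vec n" "x \<noteq> 0\<^sub>v n"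
  shows "l2norm (of_real (1 / l2norm x) \<cdot>\<^sub>v x) = 1"
proof -
  have "l2norm x \<noteq> 0" using assms l2norm_eq_0_iff by blast
  then show ?thesis by (simp add: l2norm_smult norm_divide)
qed

lemma continuous_on_pnorm_mult_mat_vec:
  fixes A :: "'a::real_normed_field mat"
  assumes n: "0 < n" and p: "1 \<le> p" and A: "A \<in> carrier_mat n m"
  shows "continuous_on S (\<lambda>g. pnorm p (A *\<^sub>v vec m g))"
proof -
  have eq: "A *\<^sub>v vec m g = vec n (\<lambda>i. \<Sum>j<m. A $$ (i,j) * g j)" for g
    using A by (auto intro!: eq_vecI sum.cong simp: scalar_prod_def atLeast0LessThan)
  show ?thesis unfolding eq
    by (intro continuous_on_pnorm[OF n p] continuous_intros)
      (rule continuous_on_subset[OF continuous_on_product_coordinates], simp)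
qed

definition orthonormal :: "nat \<Rightarrow> nat \<Rightarrow> (nat \<Rightarrow> 'a::real_or_complex vec) \<Rightarrow> bool" where
  "orthonormal k m v \<longleftrightarrow> (\<forall>i<k. v i \<in> carrier_vec m) \<and>
     (\<forall>i<k. \<forall>j<k. v i \<bullet>c v j = (if i = j then 1 else 0))"

lemma orthonormal_Suc:
  assumes v: "orthonormal k m v" and x: "x \<in> unit_perp m (v ` {..<k})"
  shows "orthonormal (Suc k) m (v(k := x))"
proof -
  have xm: "x \<in> carrier_vec m" "x \<bullet>c x = 1" and xv: "\<And>i. i < k \<Longrightarrow> x \<bullet>c v i = 0"
    using x by (auto simp: unit_perp_def l2norm_eq_1_iff)
  have vx: "v i \<bullet>c x = 0" if "i < k" for i
    using conjugate_cscalar_prod[of x m "v i"] xv[OF that] xm v that by (auto simp: orthonormal_def)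
  show ?thesis using v xm xv vx by (auto simp: orthonormal_def less_Suc_eq)
qed

text \<open>A dimension count by determinants: the conjugates of the fewer than \<open>m\<close>
  vectors are the first rows of a square matrix whose row \<open>k\<close> is zero. Its determinant
  vanishes, and a nonzero kernel vector is orthogonal to all of them; it only remains to normalize
  it.\<close>

lemma unit_perp_nonempty:
  fixes v :: "nat \<Rightarrow> 'a::real_or_complex vec"
  assumes k: "k < m" and v: "\<And>i. i < k \<Longrightarrow> v i \<in> carrier_vec m"
  shows "unit_perp m (v ` {..<k}) \<noteq> {}"
proof -
  let ?c = "\<lambda>i. if i < k then conjugate (v i) else 0\<^sub>v m"
  let ?M = "mat\<^sub>r m m (\<lambda>i. if i = k then 0\<^sub>v m else ?c i)"
  have "det ?M = 0" using k v by (intro det_row_0) auto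
  then obtain x where x: "x \<in> carrier_vec m" "x \<noteq> 0\<^sub>v m" "?M *\<^sub>v x = 0\<^sub>v m"
    using det_0_iff_vec_prod_zero_field[of ?M m] by auto
  have xv: "x \<bullet>c v i = 0" if "i < k" for i
  proof -
    have "conjugate (v i) \<bullet> x = (?M *\<^sub>v x) $ i"
      using that k v[OF that] by simp
    then show ?thesis using that k x v comm_scalar_prod[of x m "conjugate (v i)"] by simp
  qed
  have "of_real (1 / l2norm x) \<cdot>\<^sub>v x \<in> unit_perp m (v ` {..<k})"
    unfolding unit_perp_def using l2norm_normalize[OF x(1,2)] x(1) xv v by auto
  then show ?thesis by blast
qed

lemma orthonormal_extend:
  fixes v :: "nat \<Rightarrow> 'a::real_or_complex vec"
  assumes "orthonormal k m v" "k \<le> m"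
  obtains w where "orthonormal m m w" "\<And>i. i < k \<Longrightarrow> w i = v i"
  using assms
proof (induction "m - k" arbitrary: k v thesis)
  case 0
  then show ?case by (metis diff_is_0_eq le_antisym)
next
  case (Suc d)
  then have k: "k < m" by simp
  obtain x where "x \<in> unit_perp m (v ` {..<k})"
    using unit_perp_nonempty[OF k, of v] Suc.prems by (auto simp: orthonormal_def)
  then have o: "orthonormal (Suc k) m (v(k := x))"
    by (rule orthonormal_Suc[OF Suc.prems(2)])
  show ?case
  proof (rule Suc.hyps(1)[OF _ _ o])
    show "d = m - Suc k" "Suc k \<le> m" using Suc.hyps(2) k by auto
    show thesis if "orthonormal m m w" "\<And>i. i < Suc k \<Longrightarrow> w i = (v(k := x)) i" for w
      using that by (intro Suc.prems(1)[of w]) (auto simp: less_Suc_eq)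
  qed
qed

definition basis_mat :: "nat \<Rightarrow> (nat \<Rightarrow> 'a vec) \<Rightarrow> 'a mat" where
  "basis_mat m v = mat m m (\<lambda>(i,j). v j $ i)"

lemma basis_mat_carrier [simp]: "basis_mat m v \<in> carrier_mat m m"
  by (simp add: basis_mat_def)

lemma col_basis_mat [simp]: "j < m \<Longrightarrow> v j \<in> carrier_vec m \<Longrightarrow> col (basis_mat m v) j = v j"
  by (auto simp: basis_mat_def)

text \<open>The adjoint times the matrix is the Gram matrix of the columns, so orthonormality gives
  a left inverse, which for a square matrix is also a right inverse.\<close>

lemma unitary_basis_mat:
  assumes v: "orthonormal m m v"
  shows "unitary_mat m (basis_mat m v)"
proof -
  let ?U = "basis_mat m v"
  have "adjoint_mat ?U * ?U = 1\<^sub>m m"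
  proof (rule eq_matI)
    fix i j assume "i < dim_row (1\<^sub>m m)" "j < dim_col (1\<^sub>m m)"
    then have ij: "i < m" "j < m" by auto
    then have vij: "v i \<in> carrier_vec m" "v j \<in> carrier_vec m" using v by (auto simp: orthonormal_def)
    have "row (adjoint_mat ?U) i = conjugate (v i)"
      using ij vij by (auto simp: adjoint_mat_def basis_mat_def)
    then have "(adjoint_mat ?U * ?U) $$ (i,j) = conjugate (v i) \<bullet> v j"
      using ij vij by (simp add: adjoint_mat_def col_basis_mat carrier_matD[OF basis_mat_carrier])
    also have "\<dots> = v j \<bullet>c v i" using vij by (intro comm_scalar_prod) auto
    also have "\<dots> = 1\<^sub>m m $$ (i,j)" using ij v by (auto simp: orthonormal_def)
    finally show "(adjoint_mat ?U * ?U) $$ (i,j) = 1\<^sub>m m $$ (i,j)" .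
  qed (auto simp: adjoint_mat_def carrier_matD[OF basis_mat_carrier])
  then show ?thesis unfolding unitary_mat_def
    by (simp add: mat_mult_left_right_inverse[of "adjoint_mat ?U" m ?U])
qed

lemma adjoint_mat_adjoint_mat [simp]:
  "adjoint_mat (adjoint_mat A) = (A :: 'a::conjugatable_field mat)"
  by (rule eq_matI) (auto simp: adjoint_mat_def)

lemma unitary_adjoint_mat: "unitary_mat k U \<Longrightarrow> unitary_mat k (adjoint_mat U)"
  by (simp add: unitary_mat_def)

lemma l2norm_unitary:
  fixes U :: "'a::real_or_complex mat"
  assumes U: "unitary_mat k U" and x: "x \<in> carrier_vec k"
  shows "l2norm (U *\<^sub>v x) = l2norm x"
proof -
  have Uc: "U \<in> carrier_mat k k" "adjoint_mat U * U = 1\<^sub>m k" using U by (auto simp: unitary_mat_def)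
  have "(U *\<^sub>v x) \<bullet>c (U *\<^sub>v x) = x \<bullet>c (adjoint_mat U *\<^sub>v (U *\<^sub>v x))"
    using Uc x by (intro cscalar_prod_adjoint_mat) auto
  also have "adjoint_mat U *\<^sub>v (U *\<^sub>v x) = (adjoint_mat U * U) *\<^sub>v x"
    using Uc x by (intro assoc_mult_mat_vec[symmetric, of _ k k _ k]) auto
  also have "\<dots> = x" using Uc x by simp
  finally have "(l2norm (U *\<^sub>v x))\<^sup>2 = (l2norm x)\<^sup>2"
    unfolding cscalar_prod_self of_real_eq_iff .
  then show ?thesis by simp
qed

lemma l2norm_col_unitary:
  fixes U :: "'a::real_or_complex mat"
  assumes U: "unitary_mat k U" and j: "j < k"
  shows "l2norm (col U j) = 1"
proof -
  have Uc: "U \<in> carrier_mat k k" using U by (auto simp: unitary_mat_def)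
  have "col U j = U *\<^sub>v unit_vec k j" using Uc j by (auto intro!: eq_vecI)
  moreover have "l2norm (unit_vec k j :: 'a vec) = 1"
    using j by (simp add: l2norm_eq_1_iff)
  ultimately show ?thesis using l2norm_unitary[OF U, of "unit_vec k j"] by simp
qed

text \<open>The inner products of y with the basis are the entries of U^* y, where U has the basis
  as columns. They vanish, and U^* preserves length.\<close>

lemma orthonormal_basis_perp_0:
  assumes u: "orthonormal n n u" and y: "y \<in> carrier_vec n" and perp: "\<And>i. i < n \<Longrightarrow> y \<bullet>c u i = 0"
  shows "y = 0\<^sub>v n"
proof -
  let ?U = "basis_mat n u"
  have U: "unitary_mat n ?U" using u by (rule unitary_basis_mat)
  have un: "u i \<in> carrier_vec n" if "i < n" for i using u that by (auto simp: orthonormal_def)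
  have "(adjoint_mat ?U *\<^sub>v y) $ i = 0" if i: "i < n" for i
  proof -
    have "row (adjoint_mat ?U) i = conjugate (u i)"
      using i un[OF i] by (auto simp: adjoint_mat_def basis_mat_def)
    then have "(adjoint_mat ?U *\<^sub>v y) $ i = conjugate (u i) \<bullet> y"
      using i by (simp add: adjoint_mat_def carrier_matD[OF basis_mat_carrier])
    also have "\<dots> = y \<bullet>c u i" using un[OF i] y by (intro comm_scalar_prod) auto
    finally show ?thesis using perp[OF i] by simp
  qed
  then have "adjoint_mat ?U *\<^sub>v y = 0\<^sub>v n"
    by (intro eq_vecI) (auto simp: adjoint_mat_def carrier_matD[OF basis_mat_carrier])
  then have "l2norm y = l2norm (0\<^sub>v n :: 'a vec)"
    using l2norm_unitary[OF unitary_adjoint_mat[OF U] y] by simp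
  then show ?thesis using y by (simp add: l2norm_eq_0_iff[symmetric] l2norm_def)
qed

section \<open>Singular value decomposition with a prescribed first singular pair\<close>

text \<open>
  The hypothesis on $w = A^* u$ forces $\|w\|_2 \le \sigma$, while $\langle v, w\rangle = \sigma$;
  hence $\|w - \sigma v\|_2^2 = \|w\|_2^2 - \sigma^2 \le 0$.
\<close>

lemma adjoint_mult_maximizer:
  fixes A :: "'a::real_or_complex mat"
  assumes A: "A \<in> carrier_mat n m"
    and v: "v \<in> carrier_vec m" "l2norm v = 1" and u: "u \<in> carrier_vec n" "l2norm u = 1"
    and Av: "A *\<^sub>v v = of_real \<sigma> \<cdot>\<^sub>v u" and \<sigma>: "0 \<le> \<sigma>"
    and le: "l2norm (A *\<^sub>v (adjoint_mat A *\<^sub>v u)) \<le> \<sigma> * l2norm (adjoint_mat A *\<^sub>v u)"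
  shows "adjoint_mat A *\<^sub>v u = of_real \<sigma> \<cdot>\<^sub>v v"
proof -
  let ?w = "adjoint_mat A *\<^sub>v u"
  have w: "?w \<in> carrier_vec m" using A u by (intro mult_mat_vec_carrier[of _ m n]) auto
  have Aw: "A *\<^sub>v ?w \<in> carrier_vec n" using A w by simp
  have vv: "v \<bullet>c v = 1" and uu: "u \<bullet>c u = 1" using u v by (simp_all flip: l2norm_eq_1_iff)
  \<comment> \<open>One factor \<open>?w\<close> is the adjoint applied to \<open>u\<close>, so A
    can be moved to the other factor. Cauchy-Schwarz and \<open>le\<close> then bound the squared
    length of \<open>?w\<close> by \<sigma> times its length, and one factor cancels.\<close>
  have ww: "?w \<bullet>c ?w = (A *\<^sub>v ?w) \<bullet>c u"
    using cscalar_prod_adjoint_mat[OF A w u(1)] by simp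
  have "(l2norm ?w)\<^sup>2 = norm (?w \<bullet>c ?w)"
    unfolding cscalar_prod_self norm_of_real by simp
  also have "\<dots> \<le> l2norm (A *\<^sub>v ?w) * l2norm u"
    unfolding ww by (rule cscalar_prod_Cauchy_Schwarz[OF Aw u(1)])
  also have "\<dots> \<le> \<sigma> * l2norm ?w" using le u by simp
  finally have sq: "(l2norm ?w)\<^sup>2 \<le> \<sigma> * l2norm ?w" .
  have "l2norm ?w \<le> \<sigma>"
    using sq \<sigma> l2norm_nonneg[of ?w] by (cases "l2norm ?w = 0") (auto simp: power2_eq_square)
  then have sq: "(l2norm ?w)\<^sup>2 \<le> \<sigma>\<^sup>2" by (intro power_mono) auto
  have vw: "v \<bullet>c ?w = of_real \<sigma>"
    using cscalar_prod_adjoint_mat[OF A v(1) u(1)] u uu by (simp add: Av)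
  have wv: "?w \<bullet>c v = of_real \<sigma>"
    using conjugate_cscalar_prod[OF v(1) w] vw by simp
  let ?d = "?w - of_real \<sigma> \<cdot>\<^sub>v v"
  have d: "?d \<in> carrier_vec m" using w v by simp
  have "conjugate ?d = conjugate ?w - of_real \<sigma> \<cdot>\<^sub>v conjugate v"
  proof (rule eq_vecI)
    fix i assume "i < dim_vec (conjugate ?w - of_real \<sigma> \<cdot>\<^sub>v conjugate v)"
    then have i: "i < m" using v by simp
    have "conjugate (a - of_real \<sigma> * b) = conjugate a - of_real \<sigma> * conjugate b" for a b :: 'a
      using conjugate_dist_add[of a "- (of_real \<sigma> * b)"] by (simp add: conjugate_neg conjugate_dist_mul)
    then show "conjugate ?d $ i = (conjugate ?w - of_real \<sigma> \<cdot>\<^sub>v conjugate v) $ i"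
      using i v carrier_vecD[OF w] by (simp del: index_mult_mat_vec)
  qed (use v in simp)
  then have "?d \<bullet>c ?d = ?d \<bullet> (conjugate ?w - of_real \<sigma> \<cdot>\<^sub>v conjugate v)" by simp
  also have "\<dots> = ?d \<bullet> conjugate ?w - ?d \<bullet> (of_real \<sigma> \<cdot>\<^sub>v conjugate v)"
    using d w v by (intro scalar_prod_minus_distrib[of _ m]) auto
  also have "?d \<bullet> (of_real \<sigma> \<cdot>\<^sub>v conjugate v) = of_real \<sigma> * (?d \<bullet>c v)"
    using d v by (intro scalar_prod_smult_distrib[of _ m]) auto
  also have "?d \<bullet>c v = ?w \<bullet>c v - (of_real \<sigma> \<cdot>\<^sub>v v) \<bullet>c v"
    using d w v by (intro minus_scalar_prod_distrib[of _ m]) auto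
  also have "(of_real \<sigma> \<cdot>\<^sub>v v) \<bullet>c v = of_real \<sigma>"
    using v vv by (subst smult_scalar_prod_distrib[of _ m]) auto
  also have "?d \<bullet>c ?w = ?w \<bullet>c ?w - (of_real \<sigma> \<cdot>\<^sub>v v) \<bullet>c ?w"
    using d w v by (intro minus_scalar_prod_distrib[of _ m]) auto
  also have "(of_real \<sigma> \<cdot>\<^sub>v v) \<bullet>c ?w = of_real \<sigma> * of_real \<sigma>"
    using v w vw by (subst smult_scalar_prod_distrib[of _ m]) auto
  finally have "(of_real ((l2norm ?d)\<^sup>2) :: 'a) = of_real ((l2norm ?w)\<^sup>2 - \<sigma>\<^sup>2)"
    unfolding wv cscalar_prod_self by (simp add: power2_eq_square)
  then have "(l2norm ?d)\<^sup>2 = (l2norm ?w)\<^sup>2 - \<sigma>\<^sup>2" unfolding of_real_eq_iff .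
  then have "l2norm ?d = 0" using sq by (metis diff_le_0_iff_le power2_less_eq_zero_iff)
  then have d0: "?d = 0\<^sub>v m" using l2norm_eq_0_iff[OF d] by simp
  show ?thesis
  proof (rule eq_vecI)
    fix i assume "i < dim_vec (of_real \<sigma> \<cdot>\<^sub>v v)"
    then have i: "i < m" using v by simp
    have "?d $ i = 0" using i by (simp add: d0)
    then show "?w $ i = (of_real \<sigma> \<cdot>\<^sub>v v) $ i"
      using i v carrier_vecD[OF w] by (simp del: index_mult_mat_vec)
  qed (use v carrier_vecD[OF w] in simp)
qed

text \<open>A partial singular value decomposition with k triples. The relation for A makes
  \<open>adjoint_mat A\<close> map the complement of the u's into that of the v's; the relation for
  \<open>adjoint_mat A\<close> does the same for A in the other direction.\<close>

definition singular_system :: "nat \<Rightarrow> nat \<Rightarrow> nat \<Rightarrow> 'a::real_or_complex mat \<Rightarrow>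
    (nat \<Rightarrow> real) \<Rightarrow> (nat \<Rightarrow> 'a vec) \<Rightarrow> (nat \<Rightarrow> 'a vec) \<Rightarrow> bool" where
  "singular_system k n m A \<sigma> u v \<longleftrightarrow> orthonormal k n u \<and> orthonormal k m v \<and>
     (\<forall>i<k. 0 \<le> \<sigma> i \<and> A *\<^sub>v v i = of_real (\<sigma> i) \<cdot>\<^sub>v u i \<and>
        adjoint_mat A *\<^sub>v u i = of_real (\<sigma> i) \<cdot>\<^sub>v v i)"

text \<open>Moving the adjoint across turns the inner product into \<sigma> i times that of y with u
  i. Applied to the swapped system, the lemma gives the corresponding statement for A.\<close>

lemma unit_perp_adjoint:
  assumes A: "A \<in> carrier_mat n m" and sys: "singular_system k n m A \<sigma> u v"
    and y: "y \<in> carrier_vec n" and perp: "\<And>i. i < k \<Longrightarrow> y \<bullet>c u i = 0" and i: "i < k"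
  shows "(adjoint_mat A *\<^sub>v y) \<bullet>c v i = 0"
proof -
  have ui: "u i \<in> carrier_vec n" "v i \<in> carrier_vec m"
    using sys i by (auto simp: singular_system_def orthonormal_def)
  have "(adjoint_mat A *\<^sub>v y) \<bullet>c v i = y \<bullet>c (A *\<^sub>v v i)"
    using cscalar_prod_adjoint_mat[OF adjoint_mat_carrier[OF A] y ui(2)] by simp
  also have "A *\<^sub>v v i = of_real (\<sigma> i) \<cdot>\<^sub>v u i" using sys i by (simp add: singular_system_def)
  also have "y \<bullet>c (of_real (\<sigma> i) \<cdot>\<^sub>v u i) = of_real (\<sigma> i) * (y \<bullet>c u i)"
    using y ui by (simp add: conjugate_smult_vec)
  finally show ?thesis using perp[OF i] by simp
qed

lemma singular_system_swap:
  "singular_system k n m A \<sigma> u v \<Longrightarrow> singular_system k m n (adjoint_mat A) \<sigma> v u"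
  by (auto simp: singular_system_def)

text \<open>The new right vector x maximizes the length of A x on the unit sphere orthogonal to the
  old ones, and y is the direction of A x. The bound needed by \<open>adjoint_mult_maximizer\<close>
  is known only on that complement, but A^* y lies in it because y is orthogonal to the old left
  vectors.\<close>

lemma singular_system_Suc:
  fixes A :: "'a::real_or_complex mat"
  assumes A: "A \<in> carrier_mat n m" and sys: "singular_system k n m A \<sigma> u v"
    and k: "k < n" "k < m"
  obtains s x y where "singular_system (Suc k) n m A (\<sigma>(k := s)) (u(k := y)) (v(k := x))"
proof -
  have uv: "orthonormal k n u" "orthonormal k m v" using sys by (auto simp: singular_system_def)
  let ?P = "unit_perp m (v ` {..<k})" and ?Q = "unit_perp n (u ` {..<k})"
  have ne: "?P \<noteq> {}" "?Q \<noteq> {}"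
    using uv k by (intro unit_perp_nonempty; simp add: orthonormal_def)+
  have "\<exists>x\<in>?P. \<forall>z\<in>?P. l2norm (A *\<^sub>v z) \<le> l2norm (A *\<^sub>v x)"
  proof (rule attains_max_on_unit_perp)
    show "0 < m" "unit_perp m (v ` {..<k}) \<noteq> {}" using k ne by auto
    show "v ` {..<k} \<subseteq> carrier_vec m" using uv by (auto simp: orthonormal_def)
    have "(1::ereal) \<le> 2" by simp
    then show "continuous_on {g. vec m g \<in> ?P} (\<lambda>g. l2norm (A *\<^sub>v vec m g))"
      using continuous_on_pnorm_mult_mat_vec[of n 2 A m, OF _ _ A, unfolded pnorm_2] k by blast
  qed
  then obtain x where x: "x \<in> ?P" "\<forall>z\<in>?P. l2norm (A *\<^sub>v z) \<le> l2norm (A *\<^sub>v x)" ..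
  have xm: "x \<in> carrier_vec m" "l2norm x = 1" "\<And>i. i < k \<Longrightarrow> x \<bullet>c v i = 0"
    using x(1) by (auto simp: unit_perp_def)
  define s where "s = l2norm (A *\<^sub>v x)"
  have s: "0 \<le> s" by (simp add: s_def)
  have Ax: "A *\<^sub>v x \<in> carrier_vec n" using A xm by simp
  have Axu: "(A *\<^sub>v x) \<bullet>c u i = 0" if "i < k" for i
    using unit_perp_adjoint[OF adjoint_mat_carrier[OF A] singular_system_swap[OF sys] xm(1) xm(3) that] by simp
  \<comment> \<open>If s = 0 then A x has no direction, and any unit vector orthogonal to the old
    left vectors serves; one exists because k < n.\<close>
  obtain y where y: "y \<in> ?Q" "A *\<^sub>v x = of_real s \<cdot>\<^sub>v y"
  proof (cases "s = 0")
    case True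
    obtain y where "y \<in> ?Q" using ne by blast
    moreover have "A *\<^sub>v x = 0\<^sub>v n" using True l2norm_eq_0_iff[OF Ax] by (simp add: s_def)
    moreover have "of_real s \<cdot>\<^sub>v y = 0\<^sub>v n"
      using True \<open>y \<in> ?Q\<close> by (auto simp: unit_perp_def)
    ultimately show thesis using that[of y] by metis
  next
    case False
    let ?y = "of_real (1 / s) \<cdot>\<^sub>v (A *\<^sub>v x)"
    have "A *\<^sub>v x \<noteq> 0\<^sub>v n" using False l2norm_eq_0_iff[OF Ax] by (simp add: s_def)
    then have "l2norm ?y = 1" unfolding s_def by (rule l2norm_normalize[OF Ax])
    moreover have "?y \<bullet>c u i = 0" if "i < k" for i
    proof -
      have "u i \<in> carrier_vec n" using uv(1) that by (simp add: orthonormal_def)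
      then show ?thesis
        using smult_scalar_prod_distrib[OF Ax, of "conjugate (u i)" "of_real (1 / s)"] Axu[OF that]
        by (metis carrier_vec_conjugate mult_zero_right)
    qed
    ultimately have "?y \<in> ?Q" using Ax by (auto simp: unit_perp_def)
    moreover have "A *\<^sub>v x = of_real s \<cdot>\<^sub>v ?y"
      using False Ax by (auto simp: smult_smult_assoc)
    ultimately show thesis using that by blast
  qed
  have yn: "y \<in> carrier_vec n" "l2norm y = 1" "\<And>i. i < k \<Longrightarrow> y \<bullet>c u i = 0"
    using y(1) by (auto simp: unit_perp_def)
  let ?w = "adjoint_mat A *\<^sub>v y"
  have w: "?w \<in> carrier_vec m" using A yn by (intro mult_mat_vec_carrier[of _ m n]) auto
  \<comment> \<open>Maximality of s concerns unit vectors of \<open>?P\<close> only, so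
    \<open>?w\<close> is normalized and its orthogonality to the old right vectors is
    checked.\<close>
  have "l2norm (A *\<^sub>v ?w) \<le> s * l2norm ?w"
  proof (cases "?w = 0\<^sub>v m")
    case True
    moreover have "A *\<^sub>v 0\<^sub>v m = 0\<^sub>v n" using A by (auto intro!: eq_vecI)
    ultimately show ?thesis by (simp add: l2norm_def s_def)
  next
    case False
    let ?z = "of_real (1 / l2norm ?w) \<cdot>\<^sub>v ?w"
    have "?z \<bullet>c v i = 0" if i: "i < k" for i
    proof -
      have "v i \<in> carrier_vec m" using uv i by (auto simp: orthonormal_def)
      then show ?thesis
        using smult_scalar_prod_distrib[OF w, of "conjugate (v i)" "of_real (1 / l2norm ?w)"]
          unit_perp_adjoint[OF A sys yn(1) yn(3) i]
        by (metis carrier_vec_conjugate mult_zero_right)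
    qed
    then have "?z \<in> ?P" using l2norm_normalize[OF w False] w by (auto simp: unit_perp_def)
    then have "l2norm (A *\<^sub>v ?z) \<le> s" unfolding s_def by (rule x(2)[rule_format])
    moreover have "A *\<^sub>v ?z = of_real (1 / l2norm ?w) \<cdot>\<^sub>v (A *\<^sub>v ?w)"
      using mult_mat_vec[OF A w] .
    moreover have "0 < l2norm ?w" using False l2norm_eq_0_iff[OF w] by (simp add: order_less_le)
    ultimately show ?thesis by (simp add: l2norm_smult norm_divide field_simps)
  qed
  then have "?w = of_real s \<cdot>\<^sub>v x"
    using adjoint_mult_maximizer[OF A xm(1,2) yn(1,2) y(2) s] by blast
  then have "singular_system (Suc k) n m A (\<sigma>(k := s)) (u(k := y)) (v(k := x))"
    using sys orthonormal_Suc[OF uv(1) y(1)] orthonormal_Suc[OF uv(2) x(1)] y(2) s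
    by (auto simp: singular_system_def less_Suc_eq)
  then show thesis by (rule that)
qed

text \<open>That the first k triples stay unchanged is what lets a prescribed singular pair survive
  into the full decomposition.\<close>

lemma singular_system_extend:
  fixes A :: "'a::real_or_complex mat"
  assumes A: "A \<in> carrier_mat n m" and "singular_system k n m A \<sigma> u v" "k \<le> min n m"
  obtains \<sigma>' u' v' where "singular_system (min n m) n m A \<sigma>' u' v'"
    "\<And>i. i < k \<Longrightarrow> \<sigma>' i = \<sigma> i \<and> u' i = u i \<and> v' i = v i"
  using assms(2,3)
proof (induction "min n m - k" arbitrary: k \<sigma> u v thesis)
  case 0
  then have k: "k = min n m" by simp
  show ?case using 0 unfolding k by auto
next
  case (Suc d)
  then have k: "k < n" "k < m" by auto
  obtain s x y where sys: "singular_system (Suc k) n m A (\<sigma>(k := s)) (u(k := y)) (v(k := x))"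
    using singular_system_Suc[OF A Suc.prems(2) k] .
  show ?case
  proof (rule Suc.hyps(1)[OF _ _ sys])
    show "d = min n m - Suc k" "Suc k \<le> min n m" using Suc.hyps(2) k by auto
    show thesis if sys': "singular_system (min n m) n m A \<sigma>' u' v'"
      and *: "\<And>i. i < Suc k \<Longrightarrow>
        \<sigma>' i = (\<sigma>(k := s)) i \<and> u' i = (u(k := y)) i \<and> v' i = (v(k := x)) i" for \<sigma>' u' v'
    proof (rule Suc.prems(1)[OF sys'])
      fix i assume "i < k"
      then show "\<sigma>' i = \<sigma> i \<and> u' i = u i \<and> v' i = v i" using *[of i] by simp
    qed
  qed
qed

section \<open>Assembling the full decomposition\<close>

lemma mult_mat_vec_zero: "A \<in> carrier_mat n m \<Longrightarrow> A *\<^sub>v 0\<^sub>v m = 0\<^sub>v n"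
  by (auto intro!: eq_vecI)

lemma mult_mat_vec_unit_vec:
  "A \<in> carrier_mat n m \<Longrightarrow> j < m \<Longrightarrow> A *\<^sub>v unit_vec m j = col (A :: 'a::semiring_1 mat) j"
  by (auto intro!: eq_vecI)

text \<open>Both families are completed to orthonormal bases, and A V = U \<Sigma> is checked column
  by column. The only columns not covered by the given triples occur for m > n, and there A has to
  vanish.\<close>

lemma is_svd_of_singular_system:
  fixes A :: "'a::real_or_complex mat"
  assumes A: "A \<in> carrier_mat n m" and sys: "singular_system (min n m) n m A \<sigma> u v"
  obtains U V where
    "is_svd n m A U (mat n m (\<lambda>(i,j). if i = j then of_real (\<sigma> i) else 0)) V"
    "\<And>i. i < min n m \<Longrightarrow> col U i = u i \<and> col V i = v i"
proof -
  let ?k = "min n m" and ?\<Sigma> = "mat n m (\<lambda>(i,j). if i = j then of_real (\<sigma> i) else 0) :: 'a mat"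
  have uv: "orthonormal ?k n u" "orthonormal ?k m v"
    and \<sigma>: "\<And>i. i < ?k \<Longrightarrow> 0 \<le> \<sigma> i"
    and Av: "\<And>i. i < ?k \<Longrightarrow> A *\<^sub>v v i = of_real (\<sigma> i) \<cdot>\<^sub>v u i"
    using sys by (auto simp: singular_system_def)
  obtain u' where u': "orthonormal n n u'" "\<And>i. i < ?k \<Longrightarrow> u' i = u i"
    using orthonormal_extend[OF uv(1)] by auto
  obtain v' where v': "orthonormal m m v'" "\<And>i. i < ?k \<Longrightarrow> v' i = v i"
    using orthonormal_extend[OF uv(2)] by auto
  let ?U = "basis_mat n u'" and ?V = "basis_mat m v'"
  have un: "u' i \<in> carrier_vec n" if "i < n" for i using u' that by (simp add: orthonormal_def)
  have vm: "v' i \<in> carrier_vec m" if "i < m" for i using v' that by (simp add: orthonormal_def)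
  have U: "unitary_mat n ?U" and V: "unitary_mat m ?V"
    using u' v' by (auto intro: unitary_basis_mat)
  have Sc: "?\<Sigma> \<in> carrier_mat n m" by simp
  have "A *\<^sub>v v' j = ?U *\<^sub>v col ?\<Sigma> j" if j: "j < m" for j
  proof (cases "j < n")
    case True
    then have jk: "j < ?k" using j by simp
    have "col ?\<Sigma> j = of_real (\<sigma> j) \<cdot>\<^sub>v unit_vec n j" using True j by (auto intro!: eq_vecI)
    then have "?U *\<^sub>v col ?\<Sigma> j = of_real (\<sigma> j) \<cdot>\<^sub>v (?U *\<^sub>v unit_vec n j)"
      by (simp add: mult_mat_vec[OF basis_mat_carrier])
    also have "?U *\<^sub>v unit_vec n j = u' j"
      using True un by (simp add: mult_mat_vec_unit_vec[OF basis_mat_carrier])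
    finally show ?thesis using Av[OF jk] u'(2)[OF jk] v'(2)[OF jk] by simp
  next
    case False
    then have k: "?k = n" using j by simp
    have "col ?\<Sigma> j = 0\<^sub>v n" using False j by (auto intro!: eq_vecI)
    \<comment> \<open>Here j \<ge> n, so the n left vectors already form a basis. As v' j is
      orthogonal to the first n right vectors, its image is orthogonal to that whole basis.\<close>
    moreover have "A *\<^sub>v v' j = 0\<^sub>v n"
    proof (rule orthonormal_basis_perp_0[OF u'(1)])
      show "A *\<^sub>v v' j \<in> carrier_vec n" using A vm[OF j] by simp
      show "(A *\<^sub>v v' j) \<bullet>c u' i = 0" if "i < n" for i
      proof -
        have "v' j \<bullet>c v i = 0" if "i < ?k" for i
        proof -
          have "i < m" "i \<noteq> j" using that k False j by auto
          then show ?thesis using v'(1) v'(2)[OF that, symmetric] j by (simp add: orthonormal_def)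
        qed
        then have "(adjoint_mat (adjoint_mat A) *\<^sub>v v' j) \<bullet>c u i = 0"
          using that k
          by (intro unit_perp_adjoint[OF adjoint_mat_carrier[OF A] singular_system_swap[OF sys]] vm j) auto
        then show ?thesis using u'(2)[of i] that k by simp
      qed
    qed
    ultimately show ?thesis by (simp add: mult_mat_vec_zero[OF basis_mat_carrier])
  qed
  then have "A * ?V = ?U * ?\<Sigma>"
    using A vm by (intro mat_col_eqI) (auto simp: col_mult2[OF A basis_mat_carrier]
      col_mult2[OF basis_mat_carrier Sc] carrier_matD[OF basis_mat_carrier])
  then have "?U * ?\<Sigma> * adjoint_mat ?V = A * (?V * adjoint_mat ?V)"
    using assoc_mult_mat[OF A basis_mat_carrier adjoint_mat_carrier[OF basis_mat_carrier]] by metis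
  also have "\<dots> = A" using V A by (simp add: unitary_mat_def)
  finally have "is_svd n m A ?U ?\<Sigma> ?V"
    using U V \<sigma> unfolding is_svd_def by (auto intro: exI[of _ 0])
  moreover have "col ?U i = u i \<and> col ?V i = v i" if "i < ?k" for i
    using that un[of i] vm[of i] col_basis_mat[of i n u'] col_basis_mat[of i m v'] u'(2) v'(2)
    by simp
  ultimately show thesis by (rule that)
qed

text \<open>The bound \<open>le\<close> is used twice: it makes (u, v) a singular pair from which a
  system can be extended, and it makes t the largest diagonal entry.\<close>

lemma special_svd_of_maximizer:
  fixes A :: "'a::real_or_complex mat"
  assumes "0 < n" "0 < m" and A: "A \<in> carrier_mat n m"
    and u: "u \<in> Kset (esgn (2 - s)) n" "l2norm u = 1"
    and v: "v \<in> Kset (- esgn (2 - r)) m" "l2norm v = 1"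
    and Av: "A *\<^sub>v v = of_real t \<cdot>\<^sub>v u" and t: "0 \<le> t"
    and le: "\<And>x. x \<in> carrier_vec m \<Longrightarrow> l2norm (A *\<^sub>v x) \<le> t * l2norm x"
  shows "special_svd r s n m A"
proof -
  have uv: "u \<in> carrier_vec n" "v \<in> carrier_vec m" using u v by (auto simp: Kset_def)
  have "adjoint_mat A *\<^sub>v u \<in> carrier_vec m"
    using A uv by (intro mult_mat_vec_carrier[of _ m n]) auto
  then have "adjoint_mat A *\<^sub>v u = of_real t \<cdot>\<^sub>v v"
    using adjoint_mult_maximizer[OF A uv(2) v(2) uv(1) u(2) Av t le] by blast
  then have sys1: "singular_system 1 n m A (\<lambda>_. t) (\<lambda>_. u) (\<lambda>_. v)"
    using uv u v Av t by (auto simp: singular_system_def orthonormal_def simp flip: l2norm_eq_1_iff)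
  obtain \<sigma> u' v' where sys: "singular_system (min n m) n m A \<sigma> u' v'"
    and "\<And>i. i < 1 \<Longrightarrow> \<sigma> i = t \<and> u' i = u \<and> v' i = v"
    using singular_system_extend[OF A sys1] assms(1,2) by auto
  then have eq0: "\<sigma> 0 = t" "u' 0 = u" "v' 0 = v" by auto
  let ?\<Sigma> = "mat n m (\<lambda>(i,j). if i = j then of_real (\<sigma> i) else 0) :: 'a mat"
  obtain U V where svd: "is_svd n m A U ?\<Sigma> V"
    and UV: "\<And>i. i < min n m \<Longrightarrow> col U i = u' i \<and> col V i = v' i"
    using is_svd_of_singular_system[OF A sys] by blast
  \<comment> \<open>A maps the unit vector v' i to a vector of length \<sigma> i, so the bound on A
    itself controls the later singular values.\<close>
  have \<sigma>: "\<bar>\<sigma> i\<bar> \<le> t" if i: "i < n" "i < m" for i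
  proof -
    have *: "u' i \<in> carrier_vec n" "v' i \<in> carrier_vec m" "u' i \<bullet>c u' i = 1" "v' i \<bullet>c v' i = 1"
        "A *\<^sub>v v' i = of_real (\<sigma> i) \<cdot>\<^sub>v u' i"
      using sys i by (auto simp: singular_system_def orthonormal_def)
    then have "\<bar>\<sigma> i\<bar> = l2norm (A *\<^sub>v v' i)" by (simp add: l2norm_smult flip: l2norm_eq_1_iff)
    also have "\<dots> \<le> t * l2norm (v' i)" using le *(2) .
    finally show ?thesis using * by (simp flip: l2norm_eq_1_iff)
  qed
  show ?thesis unfolding special_svd_def
  proof (intro exI conjI)
    show "is_svd n m A U ?\<Sigma> V" by (rule svd)
    show "col U 0 \<in> Kset (esgn (2 - s)) n" "col V 0 \<in> Kset (- esgn (2 - r)) m"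
      using UV[of 0] u v assms(1,2) by (auto simp: eq0)
    show "\<forall>i<n. \<forall>j<m. norm (?\<Sigma> $$ (i,j)) \<le> norm (?\<Sigma> $$ (0,0))"
      using \<sigma> assms(1,2) t by (auto simp: eq0)
  qed
qed

section \<open>Operator norms\<close>

lemma opnorm_eqI:
  fixes A :: "'a::real_normed_field mat"
  assumes m: "0 < m" and A: "A \<in> carrier_mat n m" and r: "1 \<le> r"
    and x: "x \<in> carrier_vec m" "x \<noteq> 0\<^sub>v m" "pnorm s (A *\<^sub>v x) = c * pnorm r x"
    and le: "\<And>y. y \<in> carrier_vec m \<Longrightarrow> pnorm s (A *\<^sub>v y) \<le> c * pnorm r y"
  shows "opnorm r s A = c"
  unfolding opnorm_def
proof (rule cSup_eq_maximum)
  have pos: "0 < pnorm r y" if "y \<in> carrier_vec m" "y \<noteq> 0\<^sub>v m" for y :: "'a vec"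
    using that pnorm_nonneg[OF m, of y r] pnorm_eq_0_iff[OF m _ r, of y] by (simp add: order_less_le)
  have [simp]: "dim_col A = m" using A by simp
  have "c = pnorm s (A *\<^sub>v x) / pnorm r x" using pos[OF x(1,2)] x(3) by simp
  then show "c \<in> {pnorm s (A *\<^sub>v x) / pnorm r x |x. x \<in> carrier_vec (dim_col A) \<and> x \<noteq> 0\<^sub>v (dim_col A)}"
    using x by auto
  fix z assume "z \<in> {pnorm s (A *\<^sub>v x) / pnorm r x |x. x \<in> carrier_vec (dim_col A) \<and> x \<noteq> 0\<^sub>v (dim_col A)}"
  then obtain y where y: "y \<in> carrier_vec m" "y \<noteq> 0\<^sub>v m" "z = pnorm s (A *\<^sub>v y) / pnorm r y" by auto
  then show "z \<le> c" using le[OF y(1)] pos[OF y(1,2)] by (simp add: pos_divide_le_eq)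
qed

text \<open>The quotient of the two norms does not change under scaling, so its maximum over the
  Euclidean unit sphere is its maximum over all nonzero vectors. Normalizing in the Euclidean norm,
  whatever r is, gives directly a unit vector of the kind a singular pair needs.\<close>

lemma opnorm_maximizer:
  fixes A :: "'a::real_or_complex mat"
  assumes n: "0 < n" and m: "0 < m" and A: "A \<in> carrier_mat n m" and r: "1 \<le> r" and s: "1 \<le> s"
  obtains x where "x \<in> carrier_vec m" "l2norm x = 1" "pnorm s (A *\<^sub>v x) = opnorm r s A * pnorm r x"
    "\<And>y. y \<in> carrier_vec m \<Longrightarrow> pnorm s (A *\<^sub>v y) \<le> opnorm r s A * pnorm r y"
proof -
  let ?f = "\<lambda>x. pnorm s (A *\<^sub>v x) / pnorm r x"
  have pos: "0 < pnorm r y" if "y \<in> carrier_vec m" "y \<noteq> 0\<^sub>v m" for y :: "'a vec"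
    using that pnorm_nonneg[OF m, of y r] pnorm_eq_0_iff[OF m _ r, of y] by (simp add: order_less_le)
  have nz: "y \<noteq> 0\<^sub>v m" if "l2norm y = 1" for y :: "'a vec"
    using that by (auto simp: l2norm_def)
  have "\<exists>x\<in>unit_perp m {}. \<forall>y\<in>unit_perp m {}. ?f y \<le> ?f x"
  proof (rule attains_max_on_unit_perp[OF m])
    show "unit_perp m ({} :: 'a vec set) \<noteq> {}"
      using unit_perp_nonempty[of 0 m "\<lambda>_. 0\<^sub>v m :: 'a vec"] m by simp
    show "continuous_on {g. vec m g \<in> unit_perp m {}} (\<lambda>g. ?f (vec m g))"
    proof (rule continuous_on_divide)
      show "continuous_on {g. vec m g \<in> unit_perp m {}} (\<lambda>g. pnorm s (A *\<^sub>v vec m g))"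
        by (rule continuous_on_pnorm_mult_mat_vec[OF n s A])
      show "continuous_on {g. vec m g \<in> unit_perp m {}} (\<lambda>g::nat \<Rightarrow> 'a. pnorm r (vec m g))"
        by (rule continuous_on_pnorm[OF m r])
          (rule continuous_on_subset[OF continuous_on_product_coordinates], simp)
      show "\<forall>g\<in>{g :: nat \<Rightarrow> 'a. vec m g \<in> unit_perp m {}}. pnorm r (vec m g) \<noteq> 0"
        using nz by (simp add: unit_perp_def pnorm_eq_0_iff[OF m vec_carrier r])
    qed
  qed simp
  then obtain x where x: "x \<in> carrier_vec m" "l2norm x = 1"
    and max: "\<And>y. y \<in> carrier_vec m \<Longrightarrow> l2norm y = 1 \<Longrightarrow> ?f y \<le> ?f x"
    by (auto simp: unit_perp_def)
  have xeq: "pnorm s (A *\<^sub>v x) = ?f x * pnorm r x" using pos[OF x(1) nz[OF x(2)]] by simp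
  have le: "pnorm s (A *\<^sub>v y) \<le> ?f x * pnorm r y" if y: "y \<in> carrier_vec m" for y
  proof (cases "y = 0\<^sub>v m")
    case True
    then have "pnorm s (A *\<^sub>v y) = 0" "pnorm r y = 0"
      using mult_mat_vec_zero[OF A] pnorm_eq_0_iff[OF n _ s, of "0\<^sub>v n :: 'a vec"]
        pnorm_eq_0_iff[OF m _ r, of "0\<^sub>v m :: 'a vec"] by auto
    then show ?thesis by simp
  next
    case False
    let ?c = "1 / l2norm y"
    have c: "0 < ?c" using False l2norm_eq_0_iff[OF y] by (simp add: order_less_le)
    have "?f (of_real ?c \<cdot>\<^sub>v y) \<le> ?f x"
      using y l2norm_normalize[OF y False] by (intro max) auto
    moreover have "?f (of_real ?c \<cdot>\<^sub>v y) = ?f y"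
      unfolding mult_mat_vec[OF A y] pnorm_smult[OF m y r]
        pnorm_smult[OF n mult_mat_vec_carrier[OF A y] s] norm_of_real using c by simp
    ultimately show ?thesis using pos[OF y False] by (simp add: pos_divide_le_eq)
  qed
  have "opnorm r s A = ?f x"
    by (rule opnorm_eqI[OF m A r x(1) nz[OF x(2)] xeq le])
  then show thesis using that[OF x] xeq le by simp
qed

text \<open>The positive part in the exponent joins the two comparisons: below 2 the power mean
  bound with its flat extremal vectors, above 2 monotonicity with constant 1 and sparse extremal
  vectors. At s = 2 both sides agree for every vector.\<close>

lemma pnorm_le_l2norm:
  fixes y :: "'a::real_normed_field vec"
  assumes n: "0 < n" and y: "y \<in> carrier_vec n" and s: "1 \<le> s"
  defines "C \<equiv> real n powr (max 0 (real_of_ereal (1 / s) - 1/2))"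
  shows "pnorm s y \<le> C * l2norm y" and "pnorm s y = C * l2norm y \<longleftrightarrow> y \<in> Kset (esgn (2 - s)) n"
proof -
  have half: "real_of_ereal (1 / 2) = 1 / 2" by (simp add: one_ereal_def)
  have "pnorm s y \<le> C * l2norm y \<and> (pnorm s y = C * l2norm y \<longleftrightarrow> y \<in> Kset (esgn (2 - s)) n)"
  proof (cases s "2::ereal" rule: linorder_cases)
    case less
    then obtain s' where s': "s = ereal s'" "1 \<le> s'" "s' < 2" using s by (cases s) auto
    have "esgn (2 - s) = 1" using s' by (simp add: esgn_def)
    moreover have "C = real n powr (real_of_ereal (1 / s) - real_of_ereal (1 / 2))"
      unfolding half C_def using s' by (simp add: one_ereal_def field_simps max_def)
    ultimately show ?thesis
      using pnorm_le_powr_mult_pnorm[OF n y s less] unfolding pnorm_2 by simp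
  next
    case equal
    then show ?thesis using n y half unfolding C_def equal pnorm_2 by (simp add: esgn_def Kset_def)
  next
    case greater
    have "real_of_ereal (1 / s) \<le> 1 / 2"
      using greater s by (cases s) (auto simp: one_ereal_def field_simps)
    then have "C = 1" using n by (simp add: C_def)
    moreover have "esgn (2 - s) = -1"
      using greater by (cases s) (auto simp: esgn_def)
    ultimately show ?thesis
      using pnorm_antimono[OF n y _ greater] unfolding pnorm_2 by simp
  qed
  then show "pnorm s y \<le> C * l2norm y" and "pnorm s y = C * l2norm y \<longleftrightarrow> y \<in> Kset (esgn (2 - s)) n"
    by auto
qed

text \<open>Here the Euclidean norm is the one being bounded, so the two comparisons exchange their
  ranges of exponents; this is the origin of the minus sign in the index of
  \<open>Kset\<close>.\<close>

lemma l2norm_le_pnorm: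
  fixes x :: "'a::real_normed_field vec"
  assumes m: "0 < m" and x: "x \<in> carrier_vec m" and r: "1 \<le> r"
  defines "D \<equiv> real m powr (max 0 (1/2 - real_of_ereal (1 / r)))"
  shows "l2norm x \<le> D * pnorm r x" and "l2norm x = D * pnorm r x \<longleftrightarrow> x \<in> Kset (- esgn (2 - r)) m"
proof -
  have half: "real_of_ereal (1 / 2) = 1 / 2" by (simp add: one_ereal_def)
  have "l2norm x \<le> D * pnorm r x \<and> (l2norm x = D * pnorm r x \<longleftrightarrow> x \<in> Kset (- esgn (2 - r)) m)"
  proof (cases r "2::ereal" rule: linorder_cases)
    case less
    then obtain r' where r': "r = ereal r'" "1 \<le> r'" "r' < 2" using r by (cases r) auto
    have "esgn (2 - r) = 1" using r' by (simp add: esgn_def)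
    moreover have "D = 1"
      unfolding D_def using r' m by (simp add: one_ereal_def field_simps max_def)
    ultimately show ?thesis
      using pnorm_antimono[OF m x r less] unfolding pnorm_2 by simp
  next
    case equal
    then show ?thesis using m x half unfolding D_def equal pnorm_2 by (simp add: esgn_def Kset_def)
  next
    case greater
    have "real_of_ereal (1 / r) \<le> 1 / 2"
      using greater r by (cases r) (auto simp: one_ereal_def field_simps)
    then have "D = real m powr (real_of_ereal (1 / 2) - real_of_ereal (1 / r))"
      unfolding half D_def by simp
    moreover have "esgn (2 - r) = -1"
      using greater by (cases r) (auto simp: esgn_def)
    ultimately show ?thesis
      using pnorm_le_powr_mult_pnorm[OF m x _ greater] unfolding pnorm_2 by simp
  qed
  then show "l2norm x \<le> D * pnorm r x" and "l2norm x = D * pnorm r x \<longleftrightarrow> x \<in> Kset (- esgn (2 - r)) m"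
    by auto
qed

text \<open>Needed for the zero matrix, whose singular vectors may be chosen freely. The flat vector
  serves for t = 1, and a coordinate vector for every other t.\<close>

lemma Kset_unit_vector:
  assumes "0 < n"
  obtains u :: "'a::real_or_complex vec" where "u \<in> Kset t n" "l2norm u = 1"
proof (cases "t = 1")
  case True
  let ?u = "vec n (\<lambda>_. of_real (1 / sqrt (real n))) :: 'a vec"
  have "l2norm ?u = 1" using assms by (simp add: l2norm_def norm_divide power_divide)
  moreover have "?u \<in> Kset t n" using True by (simp add: Kset_def)
  ultimately show thesis by (rule that[rotated])
next
  case False
  have "unit_vec n 0 \<in> Kset t n" using False by (auto simp: Kset_def unit_vec_def)
  moreover have "l2norm (unit_vec n 0 :: 'a vec) = 1"
    using assms by (simp add: l2norm_eq_1_iff)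
  ultimately show thesis by (rule that)
qed

lemma smult_Kset:
  fixes v :: "'a::real_normed_field vec"
  assumes v: "v \<in> Kset t n"
  shows "c \<cdot>\<^sub>v v \<in> Kset t n"
proof -
  have d: "v \<in> carrier_vec n" using v by (simp add: Kset_def)
  have flat: "norm ((c \<cdot>\<^sub>v v) $ i) = norm ((c \<cdot>\<^sub>v v) $ j)" if "t = 1" "i < n" "j < n" for i j
  proof -
    have "norm (v $ i) = norm (v $ j)" using v that unfolding Kset_def by blast
    then show ?thesis using d that by (simp add: norm_mult)
  qed
  have sparse: "i = j" if "t = -1" "i < n" "j < n" "(c \<cdot>\<^sub>v v) $ i \<noteq> 0" "(c \<cdot>\<^sub>v v) $ j \<noteq> 0" for i j
  proof -
    have "v $ i \<noteq> 0" "v $ j \<noteq> 0" using d that by auto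
    then show ?thesis using v that unfolding Kset_def by blast
  qed
  have "c \<cdot>\<^sub>v v \<in> carrier_vec n" using d by simp
  then show ?thesis using flat sparse unfolding Kset_def mem_Collect_eq by blast
qed

lemma l2norm_diagonal_le:
  fixes S :: "'a::real_normed_field mat"
  assumes S: "S \<in> carrier_mat n m" and diag: "\<And>i j. i < n \<Longrightarrow> j < m \<Longrightarrow> i \<noteq> j \<Longrightarrow> S $$ (i,j) = 0"
    and le: "\<And>i. i < n \<Longrightarrow> i < m \<Longrightarrow> norm (S $$ (i,i)) \<le> t" and t: "0 \<le> t"
    and y: "y \<in> carrier_vec m"
  shows "l2norm (S *\<^sub>v y) \<le> t * l2norm y"
proof -
  have Sy: "(S *\<^sub>v y) $ i = (if i < m then S $$ (i,i) * y $ i else 0)" if i: "i < n" for i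
  proof -
    have "(S *\<^sub>v y) $ i = (\<Sum>j<m. S $$ (i,j) * y $ j)"
      using i S y by (auto simp: scalar_prod_def atLeast0LessThan intro!: sum.cong)
    also have "\<dots> = (\<Sum>j<m. if j = i then S $$ (i,i) * y $ i else 0)"
      using diag[OF i] by (intro sum.cong) auto
    finally show ?thesis by simp
  qed
  have "(\<Sum>i<n. (norm ((S *\<^sub>v y) $ i))\<^sup>2) = (\<Sum>i<n. if i < m then (norm (S $$ (i,i) * y $ i))\<^sup>2 else 0)"
    by (intro sum.cong) (auto simp: Sy)
  also have "\<dots> = (\<Sum>i\<in>{..<n} \<inter> {..<m}. (norm (S $$ (i,i) * y $ i))\<^sup>2)"
    by (simp add: sum.inter_restrict)
  also have "\<dots> \<le> (\<Sum>i\<in>{..<n} \<inter> {..<m}. t\<^sup>2 * (norm (y $ i))\<^sup>2)"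
    using le by (intro sum_mono) (auto simp: norm_mult power_mult_distrib intro!: mult_right_mono power_mono)
  also have "\<dots> \<le> (\<Sum>i<m. t\<^sup>2 * (norm (y $ i))\<^sup>2)" by (intro sum_mono2) auto
  also have "\<dots> = t\<^sup>2 * (l2norm y)\<^sup>2" using y by (simp add: l2norm_sq sum_distrib_left)
  finally have "(l2norm (S *\<^sub>v y))\<^sup>2 \<le> (t * l2norm y)\<^sup>2"
    using S by (simp add: l2norm_sq power_mult_distrib)
  then show ?thesis by (rule power2_le_imp_le) (simp add: t)
qed

lemma norm_identity_iff_special_svd:
  fixes A :: "'a::real_or_complex mat"
  assumes n: "0 < n" and m: "0 < m" and r: "1 \<le> r" and s: "1 \<le> s" and A: "A \<in> carrier_mat n m"
  shows "norm_identity r s n m A \<longleftrightarrow> special_svd r s n m A"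
proof -
  define C where "C = real n powr (max 0 (real_of_ereal (1 / s) - 1/2))"
  define D where "D = real m powr (max 0 (1/2 - real_of_ereal (1 / r)))"
  define \<sigma> where "\<sigma> = opnorm 2 2 A"
  have C: "0 < C" and D: "0 < D" using n m by (simp_all add: C_def D_def)
  note pC = pnorm_le_l2norm[OF n _ s, folded C_def] and pD = l2norm_le_pnorm[OF m _ r, folded D_def]
  have id: "norm_identity r s n m A \<longleftrightarrow> opnorm r s A = D * C * \<sigma>"
    by (simp only: norm_identity_def C_def D_def \<sigma>_def)
  have nz: "y \<noteq> 0\<^sub>v m" if "l2norm y = 1" for y :: "'a vec"
    using that by (auto simp: l2norm_def)
  have two: "(1::ereal) \<le> 2" by simp
  show ?thesis unfolding id
  proof
    assume eq: "opnorm r s A = D * C * \<sigma>"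
    obtain z where z: "z \<in> carrier_vec m" "l2norm z = 1" "l2norm (A *\<^sub>v z) = \<sigma> * l2norm z"
      and le: "\<And>y. y \<in> carrier_vec m \<Longrightarrow> l2norm (A *\<^sub>v y) \<le> \<sigma> * l2norm y"
      using opnorm_maximizer[OF n m A two two] unfolding pnorm_2 \<sigma>_def by metis
    have \<sigma>: "0 \<le> \<sigma>" using z l2norm_nonneg[of "A *\<^sub>v z"] by simp
    show "special_svd r s n m A"
    proof (cases "\<sigma> = 0")
      case True
      \<comment> \<open>A is zero here and the chain carries no information; any unit vectors of the
        required shapes form a first singular pair.\<close>
      obtain u :: "'a vec" where u: "u \<in> Kset (esgn (2 - s)) n" "l2norm u = 1"
        using Kset_unit_vector[OF n] by blast
      obtain v :: "'a vec" where v: "v \<in> Kset (- esgn (2 - r)) m" "l2norm v = 1"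
        using Kset_unit_vector[OF m] by blast
      have uv: "u \<in> carrier_vec n" "v \<in> carrier_vec m" using u v by (auto simp: Kset_def)
      have "l2norm (A *\<^sub>v v) = 0" using le[OF uv(2)] True by (simp add: antisym)
      then have "A *\<^sub>v v = of_real \<sigma> \<cdot>\<^sub>v u"
        using l2norm_eq_0_iff[of "A *\<^sub>v v" n] A uv True by auto
      then show ?thesis using special_svd_of_maximizer[OF n m A u v _ \<sigma> le] by blast
    next
      case False
      then have pos: "0 < \<sigma>" using \<sigma> by simp
      obtain x where x: "x \<in> carrier_vec m" "l2norm x = 1" "pnorm s (A *\<^sub>v x) = opnorm r s A * pnorm r x"
        using opnorm_maximizer[OF n m A r s] by metis
      have Ax: "A *\<^sub>v x \<in> carrier_vec n" using A x by simp
      \<comment> \<open>By 4 the two ends of the chain 1, 2, 3 coincide, so all three inequalities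
        are equalities. Since C and \<sigma> are positive, the factors cancel, and each equality
        gives one property of x or A x.\<close>
      have 1: "pnorm s (A *\<^sub>v x) \<le> C * l2norm (A *\<^sub>v x)" by (rule pC(1)[OF Ax])
      have 2: "C * l2norm (A *\<^sub>v x) \<le> C * (\<sigma> * l2norm x)" using le[OF x(1)] C by simp
      have 3: "C * (\<sigma> * l2norm x) \<le> C * (\<sigma> * (D * pnorm r x))" using pD(1)[OF x(1)] C pos by simp
      have 4: "pnorm s (A *\<^sub>v x) = C * (\<sigma> * (D * pnorm r x))" using x(3) eq by simp
      have "pnorm s (A *\<^sub>v x) = C * l2norm (A *\<^sub>v x)" using 1 2 3 4 by linarith
      then have KA: "A *\<^sub>v x \<in> Kset (esgn (2 - s)) n" using pC(2)[OF Ax] by blast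
      have "C * l2norm (A *\<^sub>v x) = C * (\<sigma> * l2norm x)" using 1 2 3 4 by linarith
      then have lA: "l2norm (A *\<^sub>v x) = \<sigma>" using C x(2) by simp
      have "C * (\<sigma> * l2norm x) = C * (\<sigma> * (D * pnorm r x))" using 1 2 3 4 by linarith
      then have "l2norm x = D * pnorm r x" using C pos by simp
      then have Kx: "x \<in> Kset (- esgn (2 - r)) m" using pD(2)[OF x(1)] by blast
      let ?u = "of_real (1 / \<sigma>) \<cdot>\<^sub>v (A *\<^sub>v x)"
      have "l2norm ?u = 1" using lA pos by (simp add: l2norm_smult norm_divide)
      moreover have "A *\<^sub>v x = of_real \<sigma> \<cdot>\<^sub>v ?u" using pos by (auto simp: smult_smult_assoc)
      ultimately show ?thesis
        using special_svd_of_maximizer[OF n m A smult_Kset[OF KA] _ Kx x(2) _ \<sigma> le] by blast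
    qed
  next
    assume "special_svd r s n m A"
    then obtain U S V where svd: "is_svd n m A U S V"
      and KU: "col U 0 \<in> Kset (esgn (2 - s)) n" and KV: "col V 0 \<in> Kset (- esgn (2 - r)) m"
      and max: "\<And>i j. i < n \<Longrightarrow> j < m \<Longrightarrow> norm (S $$ (i,j)) \<le> norm (S $$ (0,0))"
      unfolding special_svd_def by blast
    have U: "unitary_mat n U" and V: "unitary_mat m V" and S: "S \<in> carrier_mat n m"
      and diag: "\<And>i j. i < n \<Longrightarrow> j < m \<Longrightarrow> i \<noteq> j \<Longrightarrow> S $$ (i,j) = 0"
      and AUSV: "A = U * S * adjoint_mat V" using svd by (auto simp: is_svd_def)
    obtain t where t: "0 \<le> t" "S $$ (0,0) = of_real t"
      using svd n m unfolding is_svd_def by blast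
    have Uc: "U \<in> carrier_mat n n" and Vc: "V \<in> carrier_mat m m"
      and V1: "adjoint_mat V * V = 1\<^sub>m m" using U V by (auto simp: unitary_mat_def)
    let ?u = "col U 0" and ?v = "col V 0"
    have uv: "?u \<in> carrier_vec n" "?v \<in> carrier_vec m" using KU KV by (auto simp: Kset_def)
    have lu: "l2norm ?u = 1" and lv: "l2norm ?v = 1"
      using l2norm_col_unitary[OF U n] l2norm_col_unitary[OF V m] by auto
    have Ay: "A *\<^sub>v y = U *\<^sub>v (S *\<^sub>v (adjoint_mat V *\<^sub>v y))" if y: "y \<in> carrier_vec m" for y
    proof -
      have "adjoint_mat V *\<^sub>v y \<in> carrier_vec m"
        using y Vc by (intro mult_mat_vec_carrier[of _ m m]) auto
      then show ?thesis
        unfolding AUSV using Uc S Vc y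
        by (simp add: assoc_mult_mat_vec[of "U * S" n m "adjoint_mat V" m]
          assoc_mult_mat_vec[of U n n S m])
    qed
    \<comment> \<open>The unitary factors preserve length, so the largest diagonal entry of S bounds
      A. As A takes the first column of V to t times the first column of U, the bound is attained
      and t is the operator norm.\<close>
    have le: "l2norm (A *\<^sub>v y) \<le> t * l2norm y" if y: "y \<in> carrier_vec m" for y
    proof -
      let ?y = "adjoint_mat V *\<^sub>v y"
      have y': "?y \<in> carrier_vec m" using y Vc by (intro mult_mat_vec_carrier[of _ m m]) auto
      have "l2norm (A *\<^sub>v y) = l2norm (S *\<^sub>v ?y)"
        unfolding Ay[OF y] using S y' by (intro l2norm_unitary[OF U]) simp
      also have "\<dots> \<le> t * l2norm ?y"
        using max t by (intro l2norm_diagonal_le[OF S diag _ _ y']) auto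
      also have "l2norm ?y = l2norm y" by (rule l2norm_unitary[OF unitary_adjoint_mat[OF V] y])
      finally show ?thesis .
    qed
    have "adjoint_mat V *\<^sub>v ?v = col (adjoint_mat V * V) 0"
      using col_mult2[OF adjoint_mat_carrier[OF Vc] Vc m] by simp
    also have "\<dots> = unit_vec m 0" using V1 m by simp
    finally have "A *\<^sub>v ?v = U *\<^sub>v (S *\<^sub>v unit_vec m 0)" using Ay[OF uv(2)] by simp
    also have "S *\<^sub>v unit_vec m 0 = of_real t \<cdot>\<^sub>v unit_vec n 0"
      unfolding mult_mat_vec_unit_vec[OF S m] using S n m diag t by (auto intro!: eq_vecI)
    also have "U *\<^sub>v (of_real t \<cdot>\<^sub>v unit_vec n 0) = of_real t \<cdot>\<^sub>v ?u"
      using mult_mat_vec[OF Uc unit_vec_carrier, of "of_real t" 0] mult_mat_vec_unit_vec[OF Uc n] by simp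
    finally have Av: "A *\<^sub>v ?v = of_real t \<cdot>\<^sub>v ?u" .
    have "pnorm 2 (A *\<^sub>v ?v) = t * pnorm 2 ?v"
      unfolding pnorm_2 Av l2norm_smult lu lv using t by simp
    then have "\<sigma> = t"
      unfolding \<sigma>_def by (rule opnorm_eqI[OF m A two uv(2) nz[OF lv]]) (unfold pnorm_2, rule le)
    moreover have "opnorm r s A = D * C * t"
    proof (rule opnorm_eqI[OF m A r uv(2) nz[OF lv]])
      have "pnorm s (A *\<^sub>v ?v) = t * pnorm s ?u"
        unfolding Av pnorm_smult[OF n uv(1) s] using t by simp
      \<comment> \<open>Both first columns have length 1, so the length of \<open>?v\<close> may
        replace that of \<open>?u\<close>; it is then converted into the r-norm, which brings in the
        factor D.\<close>
      also have "pnorm s ?u = C * l2norm ?v" using pC(2)[OF uv(1)] KU lu lv by simp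
      also have "l2norm ?v = D * pnorm r ?v" using pD(2)[OF uv(2)] KV by blast
      finally show "pnorm s (A *\<^sub>v ?v) = D * C * t * pnorm r ?v" by simp
    next
      fix y :: "'a vec" assume y: "y \<in> carrier_vec m"
      have "pnorm s (A *\<^sub>v y) \<le> C * l2norm (A *\<^sub>v y)" using A y by (intro pC(1)) simp
      also have "\<dots> \<le> C * (t * l2norm y)" using le[OF y] C by simp
      also have "\<dots> \<le> C * (t * (D * pnorm r y))"
        using pD(1)[OF y] C t by (intro mult_left_mono) auto
      finally show "pnorm s (A *\<^sub>v y) \<le> D * C * t * pnorm r y" by (simp add: mult_ac)
    qed
    ultimately show "opnorm r s A = D * C * \<sigma>" by simp
  qed
qed

theorem theorem2:
  fixes n m :: nat and r s :: ereal and A :: "real mat" and B :: "complex mat"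
  assumes "0 < n" and "0 < m"
    and "1 \<le> r" and "1 \<le> s"
    and "A \<in> carrier_mat n m" and "B \<in> carrier_mat n m"
  shows "(norm_identity r s n m A \<longleftrightarrow> special_svd r s n m A) \<and>
         (norm_identity r s n m B \<longleftrightarrow> special_svd r s n m B)"
proof
  show "norm_identity r s n m A \<longleftrightarrow> special_svd r s n m A"
    by (rule norm_identity_iff_special_svd[OF assms(1-5)])
  show "norm_identity r s n m B \<longleftrightarrow> special_svd r s n m B"
    by (rule norm_identity_iff_special_svd[OF assms(1-4,6)])
qed

end
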